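(* Let $(V,E,r)$ be a finite strongly connected directed graph with positive edge weights $r$, and let $V=\hat V\cup S$ be a partition of $V$. Let $(\hat V,\hat E,\hat r)$ be the reduced weighted graph on $\hat V$. Let $x\in\hat V$, let $\mathcal T_x$ be the set of arborescences of $(V,E)$ rooted at $x$ and $\hat{\mathcal T}_x$ the set of arborescences of $(\hat V,\hat E)$ rooted at $x$. Then $$r(\mathcal T_x)=r(\mathcal F_{\hat V})\;\hat r(\hat{\mathcal T}_x),$$ where $\mathcal F_{\hat V}$ is the collection of directed spanning forests of $(V,E)$ with root set $\hat V$.
   Context: An arborescence of a digraph rooted at $x$ is a spanning directed subgraph containing, for every vertex $y$, a unique directed path from $y$ to $x$ (the path from $x$ to itself being the trivial one); edges point towards the root. A directed spanning forest of $(V,E)$ with root set $\hat V$ is a spanning subgraph that is the disjoint union of $|\hat V|$ trees, each directed towards its root, the roots being exactly the vertices of $\hat V$ (so it has $|V|-|\hat V|$ edges, one going out of each vertex of $S$). The weight of a subgraph $\gamma$ is $r(\gamma)=\prod_{e\in\gamma}r(e)$ (empty product $=1$), and the weight of a collection $\mathcal G$ of subgraphs is $r(\mathcal G)=\sum_{\gamma\in\mathcal G}r(\gamma)$; similarly for $\hat r$. Set $r(x,y)=0$ if $(x,y)\notin E$. The reduced rates are the rates of the trace on $\hat V$ of the continuous-time Markov chain $X_t$ on $V$ with rates $r$: for $x\neq y$ in $\hat V$, $$\hat r(x,y)=r(x,y)+\sum_{z\in S}r(x,z)\,P^{\hat V}(y\,|\,z),$$ where $P^{\hat V}(y\,|\,z)$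 is the probability that $X_t$ started at $z$ first enters $\hat V$ at $y$. The reduced edge set is $\hat E=\{(x,y)\in\hat V\times\hat V: x\ne y,\ \hat r(x,y)>0\}$. *)

theory Defs
  imports "HOL-Probability.Probability" "Graph_Theory.Graph_Theory"
begin

text \<open>
  Directed paths are arc walks of \<open>Graph_Theory\<close>, i.e. repetition of vertices is not
  excluded a priori. In particular the empty walk being the only one from the root \<open>x\<close> to itself
  forbids arcs leaving the root; uniqueness of \<open>apath\<close>s alone would not.
\<close>

definition tree_towards :: "'v pair_pre_digraph \<Rightarrow> 'v \<Rightarrow> bool" where
  "tree_towards T x \<longleftrightarrow>
     pair_wf_digraph T \<and> x \<in> pverts T \<and>
     (\<forall>y\<in>pverts T. \<exists>!p. pre_digraph.awalk (with_proj T) y p x)"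

definition arborescences :: "'v pair_pre_digraph \<Rightarrow> 'v \<Rightarrow> 'v pair_pre_digraph set" where
  "arborescences G x = {H. spanning (with_proj H) (with_proj G) \<and> tree_towards H x}"

definition spanning_forests :: "'v pair_pre_digraph \<Rightarrow> 'v set \<Rightarrow> 'v pair_pre_digraph set" where
  "spanning_forests G R =
     {H. spanning (with_proj H) (with_proj G) \<and>
         (\<exists>T. (\<forall>w\<in>R. tree_towards (T w) w) \<and>
              disjoint_family_on (\<lambda>w. pverts (T w)) R \<and>
              pverts H = (\<Union>w\<in>R. pverts (T w)) \<and>
              parcs H = (\<Union>w\<in>R. parcs (T w)))}"

definition weight :: "('v \<times> 'v \<Rightarrow> real) \<Rightarrow> 'v pair_pre_digraph set \<Rightarrow> real" where
  "weight r \<G> = (\<Sum>H\<in>\<G>. \<Prod>e\<in>parcs H. r e)"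

definition edge_rate :: "'v pair_pre_digraph \<Rightarrow> ('v \<times> 'v \<Rightarrow> real) \<Rightarrow> 'v \<times> 'v \<Rightarrow> real" where
  "edge_rate G r e = (if e \<in> parcs G then r e else 0)"

text \<open>Rates of loops, if there are any, do not enter the generator.\<close>

definition generator :: "'v set \<Rightarrow> ('v \<times> 'v \<Rightarrow> real) \<Rightarrow> 'v \<Rightarrow> 'v \<Rightarrow> real" where
  "generator V c x y = (if x = y then - (\<Sum>w\<in>V - {x}. c (x, w)) else c (x, y))"

text \<open>
  The transition function of the generator \<open>q\<close> on the finite state space \<open>V\<close>, as the solution of
  the backward equation \<open>p' = q p\<close>, \<open>p 0 = 1\<close>; on \<open>V\<close> and for \<open>t \<ge> 0\<close> it is \<open>exp (t q)\<close>.
\<close>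

definition transition_function ::
    "'v set \<Rightarrow> ('v \<Rightarrow> 'v \<Rightarrow> real) \<Rightarrow> (real \<Rightarrow> 'v \<Rightarrow> 'v \<Rightarrow> real) \<Rightarrow> bool" where
  "transition_function V q p \<longleftrightarrow>
     (\<forall>x\<in>V. \<forall>y\<in>V.
        p 0 x y = (if x = y then 1 else 0) \<and>
        (\<forall>t\<ge>0. ((\<lambda>s. p s x y) has_real_derivative (\<Sum>w\<in>V. q x w * p t w y)) (at t within {0..})))"

text \<open>
  \<open>X\<close> is, under \<open>M\<close>, a continuous-time Markov chain on \<open>V\<close> with jump rates \<open>c\<close> and start \<open>z\<close>.
  The second conjunct from the end is right-continuity for the discrete topology on \<open>V\<close>; it
  holds for all sample points, so that first-entry events are measurable. The last one is the
  Markov property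
  \<open>P (X (t (n+1)) = s (n+1) | X (t 0) = s 0, ..., X (t n) = s n) = p (t (n+1) - t n) (s n) (s (n+1))\<close>,
  multiplied out.
\<close>

definition ctmc ::
    "'w measure \<Rightarrow> (real \<Rightarrow> 'w \<Rightarrow> 'v) \<Rightarrow> 'v set \<Rightarrow> ('v \<times> 'v \<Rightarrow> real) \<Rightarrow> 'v \<Rightarrow> bool" where
  "ctmc M X V c z \<longleftrightarrow>
     prob_space M \<and>
     (\<forall>t\<ge>0. X t \<in> measurable M (count_space V)) \<and>
     (AE \<omega> in M. X 0 \<omega> = z) \<and>
     (\<forall>\<omega>\<in>space M. \<forall>t\<ge>0. \<forall>\<^sub>F s in at_right t. X s \<omega> = X t \<omega>) \<and>
     (\<exists>p. transition_function V (generator V c) p \<and>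
        (\<forall>n. \<forall>t :: nat \<Rightarrow> real. \<forall>s :: nat \<Rightarrow> 'v.
           0 \<le> t 0 \<longrightarrow> (\<forall>i\<le>n. t i \<le> t (Suc i)) \<longrightarrow> (\<forall>i\<le>Suc n. s i \<in> V) \<longrightarrow>
           measure M {\<omega>\<in>space M. \<forall>i\<le>Suc n. X (t i) \<omega> = s i} =
           measure M {\<omega>\<in>space M. \<forall>i\<le>n. X (t i) \<omega> = s i} * p (t (Suc n) - t n) (s n) (s (Suc n))))"

definition first_entry_prob ::
    "'w measure \<Rightarrow> (real \<Rightarrow> 'w \<Rightarrow> 'v) \<Rightarrow> 'v set \<Rightarrow> 'v \<Rightarrow> real" where
  "first_entry_prob M X A y =
     measure M {\<omega>\<in>space M. \<exists>t\<ge>0. X t \<omega> \<in> A \<and> X t \<omega> = y \<and> (\<forall>s. 0 \<le> s \<and> s < t \<longrightarrow> X s \<omega> \<notin> A)}"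

text \<open>Here \<open>M z\<close> is the law under which the chain \<open>X\<close> starts at \<open>z\<close>.\<close>

definition reduced_rate ::
    "'v pair_pre_digraph \<Rightarrow> ('v \<times> 'v \<Rightarrow> real) \<Rightarrow> ('v \<Rightarrow> 'w measure) \<Rightarrow> (real \<Rightarrow> 'w \<Rightarrow> 'v) \<Rightarrow>
     'v set \<Rightarrow> 'v set \<Rightarrow> 'v \<times> 'v \<Rightarrow> real" where
  "reduced_rate G r M X V' S = (\<lambda>(x, y).
     edge_rate G r (x, y) + (\<Sum>z\<in>S. edge_rate G r (x, z) * first_entry_prob (M z) X V' y))"

definition reduced_graph :: "'v set \<Rightarrow> ('v \<times> 'v \<Rightarrow> real) \<Rightarrow> 'v pair_pre_digraph" where
  "reduced_graph V' r' =
     \<lparr> pverts = V', parcs = {(x, y). x \<in> V' \<and> y \<in> V' \<and> x \<noteq> y \<and> r' (x, y) > 0} \<rparr>"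

end

theory Submission
  imports Defs
begin

text \<open>
  Spanning forests with root set \<open>R\<close> are encoded by the maps \<open>f : V - R \<rightarrow> V\<close> along which every
  vertex leads to \<open>R\<close>. Cutting such a forest at a vertex \<open>v\<close> shows two things: the weight of the
  forests in which \<open>u\<close> leads into a given part of \<open>R\<close> is, as a function of \<open>u\<close>, harmonic off
  \<open>R\<close> (the sum expressing this is antisymmetric in the old and the new target of \<open>v\<close>), and the
  weight of all forests with root set \<open>R\<close> is the sum over \<open>w\<close> of \<open>c (v, w)\<close> times the weight of the
  forests with root set \<open>R \<union> {v}\<close> in which \<open>w\<close> leads into \<open>R\<close>. Averaging over the first entry
  into \<open>V'\<close> extends a function that is harmonic for the reduced rates to one that is harmonic for
  the original rates. As harmonic functions are determined by their boundary values,
  the weight of the forests on \<open>V\<close> with root set \<open>R\<close> is, for all nonempty \<open>R \<subseteq> V'\<close>, that of the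
  forests on \<open>V\<close> with root set \<open>V'\<close> times the reduced weight of the forests on \<open>V'\<close> with root set
  \<open>R\<close>; this goes by induction on \<open>|V' - R|\<close>, and the theorem is the case \<open>R = {x}\<close>.

  That the first-entry probabilities are harmonic off \<open>V'\<close> is obvious for the chain sampled at the
  multiples of \<open>\<delta>\<close>, with \<open>p \<delta>\<close> in place of the rates; dividing by \<open>\<delta>\<close> and letting \<open>\<delta> \<rightarrow> 0\<close>
  gives the claim.
\<close>

section \<open>Forests as maps\<close>

text \<open>Here \<open>\<rho>\<close> is the first vertex of \<open>R\<close> on the orbit of
  \<open>v\<close> under \<open>f\<close>. An orbit that never meets \<open>R\<close> simply has no
  \<open>\<rho>\<close>, and rule induction takes the place of path lengths.\<close>

inductive leads :: "('v \<Rightarrow> 'v) \<Rightarrow> 'v set \<Rightarrow> 'v \<Rightarrow> 'v \<Rightarrow> bool" for f R where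
  root: "\<rho> \<in> R \<Longrightarrow> leads f R \<rho> \<rho>"
| step: "v \<notin> R \<Longrightarrow> leads f R (f v) \<rho> \<Longrightarrow> leads f R v \<rho>"

lemma leads_in_roots: "leads f R v \<rho> \<Longrightarrow> \<rho> \<in> R"
  by (induction rule: leads.induct)

lemma leads_root_iff: "v \<in> R \<Longrightarrow> leads f R v \<rho> \<longleftrightarrow> \<rho> = v"
  by (metis leads.simps)

lemma leads_step_iff: "v \<notin> R \<Longrightarrow> leads f R v \<rho> \<longleftrightarrow> leads f R (f v) \<rho>"
  by (metis leads.simps)

lemma leads_unique: "leads f R v \<rho> \<Longrightarrow> leads f R v \<rho>' \<Longrightarrow> \<rho> = \<rho>'"
  by (induction arbitrary: \<rho>' rule: leads.induct) (auto simp: leads_root_iff leads_step_iff)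

lemma leads_cong:
  assumes "\<And>u. u \<notin> R \<Longrightarrow> f u = g u"
  shows "leads f R v \<rho> \<longleftrightarrow> leads g R v \<rho>"
proof -
  have "leads g R v \<rho>" if "leads f R v \<rho>" "\<And>u. u \<notin> R \<Longrightarrow> f u = g u" for f g
    using that by (induction rule: leads.induct) (auto intro: leads.intros)
  then show ?thesis using assms by metis
qed

lemma leads_fun_upd: "v \<in> R \<Longrightarrow> leads (f(v := w)) R = leads f R"
  by (intro ext leads_cong) auto

text \<open>Turning \<open>v\<close> into a root cuts the path of \<open>u\<close> at
  \<open>v\<close>: either it meets \<open>R\<close> without passing \<open>v\<close>, or it is
  stopped at \<open>v\<close> and goes on from there.\<close>

lemma leads_insert_iff:
  assumes "v \<notin> R"
  shows "leads f R u \<rho> \<longleftrightarrow>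
    \<rho> \<in> R \<and> leads f (insert v R) u \<rho> \<or> leads f (insert v R) u v \<and> leads f R v \<rho>"
proof
  assume "leads f R u \<rho>"
  then show "\<rho> \<in> R \<and> leads f (insert v R) u \<rho> \<or> leads f (insert v R) u v \<and> leads f R v \<rho>"
  proof (induction rule: leads.induct)
    case (step u \<rho>)
    then show ?case
      by (cases "u = v") (auto intro: leads.intros)
  qed (auto intro: leads.intros)
next
  have 1: "leads f (insert v R) u \<sigma> \<Longrightarrow> \<sigma> \<in> R \<Longrightarrow> leads f R u \<sigma>" for u \<sigma>
    by (induction rule: leads.induct) (auto intro: leads.intros)
  have 2: "leads f (insert v R) u \<sigma> \<Longrightarrow> leads f R \<sigma> \<rho> \<Longrightarrow> leads f R u \<rho>" for u \<sigma>
    by (induction rule: leads.induct) (auto intro: leads.intros)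
  assume "\<rho> \<in> R \<and> leads f (insert v R) u \<rho> \<or> leads f (insert v R) u v \<and> leads f R v \<rho>"
  with 1 2 show "leads f R u \<rho>" by blast
qed

text \<open>If the path of \<open>f v\<close> comes back to \<open>v\<close> before it meets
  \<open>R\<close>, the orbit of \<open>v\<close> is a cycle outside \<open>R\<close>. The induction
  shows that a vertex leading into \<open>R\<close> cannot pass through \<open>v\<close>.\<close>

lemma leads_no_cycle:
  assumes "v \<notin> R" and "leads f (insert v R) (f v) v"
  shows "\<not> leads f R v \<rho>"
proof -
  have "leads f R u \<rho> \<Longrightarrow> \<not> leads f (insert v R) u v" for u
  proof (induction rule: leads.induct)
    case (root \<rho>)
    then show ?case using assms(1) by (auto simp: leads_root_iff)
  next
    case (step u \<rho>)
    then show ?case using assms(2) by (cases "u = v") (auto simp: leads_step_iff)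
  qed
  then show ?thesis by (auto intro: leads.intros)
qed

section \<open>Weighted sums over forests, and cutting a forest at a vertex\<close>

text \<open>The maps are extensional so that each forest is counted once. That every vertex leads to
  a root excludes cycles.\<close>

definition forest_maps :: "'v set \<Rightarrow> 'v set \<Rightarrow> ('v \<Rightarrow> 'v) set" where
  "forest_maps V R = {f \<in> (V - R) \<rightarrow>\<^sub>E V. \<forall>v\<in>V. \<exists>\<rho>. leads f R v \<rho>}"

definition map_weight :: "('v \<times> 'v \<Rightarrow> real) \<Rightarrow> 'v set \<Rightarrow> 'v set \<Rightarrow> ('v \<Rightarrow> 'v) \<Rightarrow> real" where
  "map_weight c V R f = (\<Prod>v\<in>V - R. c (v, f v))"

definition forest_weight :: "('v \<times> 'v \<Rightarrow> real) \<Rightarrow> 'v set \<Rightarrow> 'v set \<Rightarrow> real" where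
  "forest_weight c V R = (\<Sum>f\<in>forest_maps V R. map_weight c V R f)"

text \<open>For \<open>T \<subseteq> R\<close> this is, in \<open>u\<close>, harmonic off
  \<open>R\<close> with boundary values \<open>forest_weight c V R\<close> on \<open>T\<close> and
  \<open>0\<close> on \<open>R - T\<close>: a Dirichlet problem solved by forests.\<close>

definition leads_weight ::
    "('v \<times> 'v \<Rightarrow> real) \<Rightarrow> 'v set \<Rightarrow> 'v set \<Rightarrow> 'v set \<Rightarrow> 'v \<Rightarrow> real" where
  "leads_weight c V R T u =
     (\<Sum>f\<in>forest_maps V R. map_weight c V R f * of_bool (\<exists>\<rho>\<in>T. leads f R u \<rho>))"

lemma finite_forest_maps: "finite V \<Longrightarrow> finite (forest_maps V R)"
  by (simp add: forest_maps_def finite_PiE)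

lemma forest_weight_all_roots: "forest_weight c V V = 1"
proof -
  have "forest_maps V V = {\<lambda>_. undefined}"
    by (auto simp: forest_maps_def intro!: leads.root)
  then show ?thesis by (simp add: forest_weight_def map_weight_def)
qed

lemma leads_weight_at_root:
  "v \<in> R \<Longrightarrow> leads_weight c V R T v = (if v \<in> T then forest_weight c V R else 0)"
  by (simp add: leads_weight_def forest_weight_def leads_root_iff)

text \<open>The cutting bijection: a forest with root set \<open>R\<close> is a forest
  \<open>g\<close> in which \<open>v\<close> is a further root, together with a target
  \<open>w\<close> for \<open>v\<close>. The target must lie outside the tree of \<open>v\<close>,
  as otherwise a cycle would close.\<close>

lemma sum_forest_maps_insert:
  fixes \<Phi> :: "('v \<Rightarrow> 'v) \<Rightarrow> real"
  assumes V: "finite V" and v: "v \<in> V - R"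
  shows "(\<Sum>f\<in>forest_maps V R. \<Phi> f) =
    (\<Sum>g\<in>forest_maps V (insert v R). \<Sum>w | w \<in> V \<and> \<not> leads g (insert v R) w v. \<Phi> (g(v := w)))"
proof -
  let ?R' = "insert v R"
  define P where "P = (SIGMA g:forest_maps V ?R'. {w. w \<in> V \<and> \<not> leads g ?R' w v})"
  have glue: "g(v := w) \<in> forest_maps V R" if "(g, w) \<in> P" for g w
  proof -
    have g: "g \<in> (V - ?R') \<rightarrow>\<^sub>E V" "\<And>u. u \<in> V \<Longrightarrow> \<exists>\<rho>. leads g ?R' u \<rho>"
      and w: "w \<in> V" "\<not> leads g ?R' w v"
      using that by (auto simp: P_def forest_maps_def)
    let ?f = "g(v := w)"
    have "?f \<in> (V - R) \<rightarrow>\<^sub>E V"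
      using g(1) w(1) v by (auto simp: PiE_iff extensional_def split: if_splits)
    moreover have "\<exists>\<rho>. leads ?f R u \<rho>" if "u \<in> V" for u
    proof -
      \<comment> \<open>The path of \<open>w\<close> ends in \<open>R\<close>, so \<open>v\<close>,
        now sent to \<open>w\<close>, leads into \<open>R\<close> as well, and every path that
        \<open>g\<close> stops at \<open>v\<close> continues into \<open>R\<close>.\<close>
      obtain \<sigma> where "leads g ?R' w \<sigma>" using g(2) w(1) by blast
      moreover from this have "\<sigma> \<in> R" using w(2) leads_in_roots by fastforce
      ultimately have "leads ?f R w \<sigma>"
        using leads_insert_iff[of v R ?f w \<sigma>] v by (simp add: leads_fun_upd)
      then have fv: "leads ?f R v \<sigma>" using leads_step_iff[of v R ?f \<sigma>] v by simp
      obtain \<tau> where \<tau>: "leads g ?R' u \<tau>" using g(2) \<open>u \<in> V\<close> by blast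
      then have "\<tau> = v \<or> \<tau> \<in> R" using leads_in_roots by fastforce
      then have "leads ?f R u \<tau> \<or> leads ?f R u \<sigma>"
        using leads_insert_iff[of v R ?f u \<tau>] leads_insert_iff[of v R ?f u \<sigma>] v \<tau> fv
        by (auto simp: leads_fun_upd)
      then show ?thesis by blast
    qed
    ultimately show ?thesis by (simp add: forest_maps_def)
  qed
  have cut: "(f(v := undefined), f v) \<in> P" if "f \<in> forest_maps V R" for f
  proof -
    have f: "f \<in> (V - R) \<rightarrow>\<^sub>E V" "\<And>u. u \<in> V \<Longrightarrow> \<exists>\<rho>. leads f R u \<rho>"
      using that by (auto simp: forest_maps_def)
    have "f(v := undefined) \<in> (V - ?R') \<rightarrow>\<^sub>E V"
      using f(1) by (auto simp: PiE_iff extensional_def)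
    moreover have "\<exists>\<rho>. leads f ?R' u \<rho>" if "u \<in> V" for u
      using f(2)[OF that] leads_insert_iff[of v R f u] v by auto
    moreover have "\<not> leads f ?R' (f v) v"
      using leads_no_cycle[of v R f] f(2)[of v] v by auto
    moreover have "f v \<in> V" using f(1) v by auto
    ultimately show ?thesis by (auto simp: P_def forest_maps_def leads_fun_upd)
  qed
  have "(\<Sum>f\<in>forest_maps V R. \<Phi> f) = (\<Sum>(g, w)\<in>P. \<Phi> (g(v := w)))"
  proof (rule sum.reindex_bij_witness[where i = "\<lambda>(g, w). g(v := w)"
        and j = "\<lambda>f. (f(v := undefined), f v)"])
    fix p assume "p \<in> P"
    moreover obtain g w where p: "p = (g, w)" by force
    \<comment> \<open>Extensionality of \<open>g\<close> makes resetting \<open>v\<close> to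
      \<open>undefined\<close> undo the gluing.\<close>
    ultimately have "g v = undefined"
      by (auto simp: P_def forest_maps_def PiE_iff extensional_def)
    then show "(\<lambda>f. (f(v := undefined), f v)) ((\<lambda>(g, w). g(v := w)) p) = p"
      by (auto simp: p)
  qed (use glue cut in auto)
  also have "\<dots> = (\<Sum>g\<in>forest_maps V ?R'. \<Sum>w | w \<in> V \<and> \<not> leads g ?R' w v. \<Phi> (g(v := w)))"
    unfolding P_def using V by (subst sum.Sigma) (auto simp: finite_forest_maps)
  finally show ?thesis .
qed

lemma map_weight_insert:
  assumes "finite V" "v \<in> V - R"
  shows "map_weight c V R (g(v := w)) = c (v, w) * map_weight c V (insert v R) g"
proof -
  have eq: "V - R = insert v (V - insert v R)" using assms(2) by auto
  have "(\<Prod>u\<in>V - insert v R. c (u, (g(v := w)) u)) = (\<Prod>u\<in>V - insert v R. c (u, g u))"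
    by (rule prod.cong) auto
  then show ?thesis
    unfolding map_weight_def eq using assms(1) by (subst prod.insert) auto
qed

text \<open>In the cut forest every vertex leads to exactly one root, so the admissible targets of
  \<open>v\<close> are those that lead into \<open>R\<close>. The term \<open>w = v\<close>
  vanishes, \<open>v\<close> being its own root there.\<close>

lemma forest_weight_insert:
  assumes V: "finite V" and v: "v \<in> V - R"
  shows "forest_weight c V R = (\<Sum>w\<in>V. c (v, w) * leads_weight c V (insert v R) R w)"
proof -
  let ?R' = "insert v R"
  have eq: "(\<not> leads g ?R' w v) = (\<exists>\<rho>\<in>R. leads g ?R' w \<rho>)"
    if g: "g \<in> forest_maps V ?R'" and w: "w \<in> V" for g w
  proof -
    obtain \<sigma> where \<sigma>: "leads g ?R' w \<sigma>"
      using g w by (auto simp: forest_maps_def)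
    then have "\<sigma> \<in> ?R'" by (rule leads_in_roots)
    moreover have "leads g ?R' w \<rho> \<longleftrightarrow> \<rho> = \<sigma>" for \<rho>
      using \<sigma> leads_unique by metis
    ultimately show ?thesis using v by auto
  qed
  have "forest_weight c V R =
    (\<Sum>g\<in>forest_maps V ?R'. \<Sum>w | w \<in> V \<and> \<not> leads g ?R' w v. c (v, w) * map_weight c V ?R' g)"
    by (simp add: forest_weight_def sum_forest_maps_insert[OF assms] map_weight_insert[OF assms])
  also have "\<dots> = (\<Sum>g\<in>forest_maps V ?R'. \<Sum>w\<in>V.
      c (v, w) * (map_weight c V ?R' g * of_bool (\<exists>\<rho>\<in>R. leads g ?R' w \<rho>)))"
    using V by (intro sum.cong[OF refl, of "forest_maps V ?R'"] sum.mono_neutral_cong_left)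
      (auto simp flip: eq)
  also have "\<dots> = (\<Sum>w\<in>V. c (v, w) * leads_weight c V ?R' R w)"
    unfolding leads_weight_def sum_distrib_left by (rule sum.swap)
  finally show ?thesis .
qed

text \<open>The generator of \<open>c\<close> annihilates \<open>h\<close> at \<open>v\<close>.
  Written with differences, it gives loops the contribution zero, whatever \<open>c (v, v)\<close>
  is.\<close>

definition harmonic_at :: "'v set \<Rightarrow> ('v \<times> 'v \<Rightarrow> real) \<Rightarrow> ('v \<Rightarrow> real) \<Rightarrow> 'v \<Rightarrow> bool" where
  "harmonic_at V c h v \<longleftrightarrow> (\<Sum>w\<in>V. c (v, w) * (h w - h v)) = 0"

text \<open>After cutting at \<open>v\<close>, the contribution of each \<open>g\<close> is a double
  sum of \<open>c (v, w) * c (v, u) * (t g u - t g w)\<close> over the old target \<open>w\<close>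
  and the new target \<open>u\<close>, which is antisymmetric.\<close>

lemma leads_weight_harmonic:
  assumes V: "finite V" and v: "v \<in> V - R" and T: "T \<subseteq> R"
  shows "harmonic_at V c (leads_weight c V R T) v"
proof -
  let ?R' = "insert v R"
  let ?N = "\<lambda>g. {w. w \<in> V \<and> \<not> leads g ?R' w v}"
  define t :: "_ \<Rightarrow> _ \<Rightarrow> real" where "t = (\<lambda>g w. of_bool (\<exists>\<rho>\<in>T. leads g ?R' w \<rho>))"
  define \<eta> :: "_ \<Rightarrow> _ \<Rightarrow> real" where "\<eta> = (\<lambda>f u. of_bool (\<exists>\<rho>\<in>T. leads f R u \<rho>))"
  \<comment> \<open>Once \<open>v\<close> is sent to \<open>w\<close>, the vertices that led to
    \<open>v\<close> acquire the root of \<open>w\<close>; all others keep theirs.\<close>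
  have \<eta>: "\<eta> (g(v := w)) u = (if leads g ?R' u v then t g w else t g u)"
    if w: "w \<in> ?N g" for g u w
  proof -
    let ?f = "g(v := w)"
    have iff: "leads ?f R u \<rho> \<longleftrightarrow> leads g ?R' u \<rho> \<or> leads g ?R' u v \<and> leads ?f R v \<rho>"
      if "\<rho> \<in> T" for u \<rho>
      using leads_insert_iff[of v R ?f u \<rho>] that v T by (auto simp: leads_fun_upd)
    have "leads ?f R v \<rho> \<longleftrightarrow> leads g ?R' w \<rho>" if "\<rho> \<in> T" for \<rho>
      using iff[OF that, of w] w v leads_step_iff[of v R ?f] by auto
    with iff have lf: "leads ?f R u \<rho> \<longleftrightarrow> leads g ?R' u \<rho> \<or> leads g ?R' u v \<and> leads g ?R' w \<rho>"
      if "\<rho> \<in> T" for \<rho>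
      using that by blast
    have "\<not> leads g ?R' u \<rho>" if "leads g ?R' u v" "\<rho> \<in> T" for \<rho>
      using leads_unique[OF that(1)] that(2) v T by blast
    then have "(\<exists>\<rho>\<in>T. leads ?f R u \<rho>) \<longleftrightarrow>
        (if leads g ?R' u v then \<exists>\<rho>\<in>T. leads g ?R' w \<rho> else \<exists>\<rho>\<in>T. leads g ?R' u \<rho>)"
      using lf by auto
    then show ?thesis by (simp add: \<eta>_def t_def)
  qed
  have zero: "(\<Sum>w\<in>?N g. c (v, w) * (\<Sum>u\<in>V. c (v, u) * (\<eta> (g(v := w)) u - \<eta> (g(v := w)) v))) = 0"
    for g
  proof -
    \<comment> \<open>Vertices \<open>u\<close> that lead to \<open>v\<close> in \<open>g\<close>
      have the same root as \<open>v\<close> and drop out. Hence \<open>u\<close> ranges over the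
      same set as \<open>w\<close>, as the antisymmetry requires.\<close>
    have "(\<Sum>u\<in>V. c (v, u) * (\<eta> (g(v := w)) u - \<eta> (g(v := w)) v)) =
        (\<Sum>u\<in>?N g. c (v, u) * (t g u - t g w))" if "w \<in> ?N g" for w
      using V by (intro sum.mono_neutral_cong_right)
        (auto simp: \<eta>[OF that] leads_root_iff)
    then have "(\<Sum>w\<in>?N g. c (v, w) * (\<Sum>u\<in>V. c (v, u) * (\<eta> (g(v := w)) u - \<eta> (g(v := w)) v))) =
        (\<Sum>w\<in>?N g. \<Sum>u\<in>?N g. c (v, w) * c (v, u) * t g u - c (v, w) * c (v, u) * t g w)"
      by (simp add: sum_distrib_left right_diff_distrib mult.assoc)
    also have "\<dots> = (\<Sum>w\<in>?N g. \<Sum>u\<in>?N g. c (v, w) * c (v, u) * t g u) -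
        (\<Sum>w\<in>?N g. \<Sum>u\<in>?N g. c (v, w) * c (v, u) * t g w)"
      by (simp only: sum_subtractf)
    also have "(\<Sum>w\<in>?N g. \<Sum>u\<in>?N g. c (v, w) * c (v, u) * t g u) =
        (\<Sum>w\<in>?N g. \<Sum>u\<in>?N g. c (v, w) * c (v, u) * t g w)"
      by (subst sum.swap) (simp add: mult.commute)
    finally show ?thesis by (simp only: diff_self)
  qed
  have "(\<Sum>u\<in>V. c (v, u) * (leads_weight c V R T u - leads_weight c V R T v)) =
      (\<Sum>f\<in>forest_maps V R. map_weight c V R f * (\<Sum>u\<in>V. c (v, u) * (\<eta> f u - \<eta> f v)))"
    unfolding leads_weight_def sum_subtractf[symmetric] sum_distrib_left
    by (subst sum.swap) (simp add: \<eta>_def algebra_simps)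
  also have "\<dots> = (\<Sum>g\<in>forest_maps V ?R'. map_weight c V ?R' g *
      (\<Sum>w\<in>?N g. c (v, w) * (\<Sum>u\<in>V. c (v, u) * (\<eta> (g(v := w)) u - \<eta> (g(v := w)) v))))"
    unfolding sum_forest_maps_insert[OF V v] map_weight_insert[OF V v]
    by (simp only: sum_distrib_left mult.assoc mult.left_commute)
  also have "\<dots> = 0" by (simp only: zero mult_zero_right sum.neutral_const)
  finally show ?thesis by (simp add: harmonic_at_def)
qed

section \<open>Arborescences and forests in digraphs\<close>

lemma awalk_with_proj_iff:
  "pre_digraph.awalk (with_proj T) u p v \<longleftrightarrow> u \<in> pverts T \<and> set p \<subseteq> parcs T \<and> pcas u p v"
  by (simp add: pre_digraph.awalk_def cas_with_proj_eq)

text \<open>Putting an arc in front of a walk to \<open>x\<close> gives another walk to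
  \<open>x\<close>. Uniqueness therefore forbids two arcs with the same tail, and also arcs leaving
  \<open>x\<close>, where the empty walk is already there. Conversely, if the arcs are the graph of
  a map, walks are forced step by step.\<close>

lemma tree_towards_iff_leads:
  "tree_towards T x \<longleftrightarrow> pair_wf_digraph T \<and> x \<in> pverts T \<and>
     (\<exists>f. parcs T = (\<lambda>v. (v, f v)) ` (pverts T - {x}) \<and> (\<forall>v\<in>pverts T. leads f {x} v x))"
  (is "_ \<longleftrightarrow> ?wf \<and> ?x \<and> ?f")
proof
  let ?awalk = "pre_digraph.awalk (with_proj T)"
  assume T: "tree_towards T x"
  then interpret pair_wf_digraph T by (simp add: tree_towards_def)
  have x: "x \<in> pverts T" and uniq: "\<And>y. y \<in> pverts T \<Longrightarrow> \<exists>!p. ?awalk y p x"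
    using T by (auto simp: tree_towards_def)
  have walk: "\<exists>p. ?awalk u ((u, v) # p) x" if arc: "(u, v) \<in> parcs T" for u v
  proof -
    obtain p where "?awalk v p x" using uniq in_arcsD2[OF arc] by blast
    then have "?awalk u ((u, v) # p) x"
      using arc in_arcsD1[OF arc] by (simp add: awalk_with_proj_iff)
    then show ?thesis ..
  qed
  have "?awalk x [] x" using x by (simp add: awalk_with_proj_iff)
  then have no_out: "(x, z) \<notin> parcs T" for z
    using walk uniq[OF x] by blast
  have functional: "z = z'" if "(y, z) \<in> parcs T" "(y, z') \<in> parcs T" for y z z'
    using walk[OF that(1)] walk[OF that(2)] uniq[OF in_arcsD1[OF that(1)]] by blast
  have "\<exists>z. (y, z) \<in> parcs T" if y: "y \<in> pverts T - {x}" for y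
  proof -
    obtain p where "?awalk y p x" using uniq y by blast
    then show ?thesis using y by (cases p) (auto simp: awalk_with_proj_iff)
  qed
  then obtain f where f: "\<And>y. y \<in> pverts T - {x} \<Longrightarrow> (y, f y) \<in> parcs T" by metis
  have arcs: "parcs T = (\<lambda>v. (v, f v)) ` (pverts T - {x})"
  proof
    show "parcs T \<subseteq> (\<lambda>v. (v, f v)) ` (pverts T - {x})"
    proof
      fix e assume e: "e \<in> parcs T"
      obtain u v where uv: "e = (u, v)" by force
      then have "u \<in> pverts T - {x}" using e no_out in_arcsD1 by blast
      moreover from this have "v = f u" using f functional e uv by blast
      ultimately show "e \<in> (\<lambda>v. (v, f v)) ` (pverts T - {x})" using uv by blast
    qed
  qed (use f in auto)
  have "leads f {x} y x" if "set p \<subseteq> parcs T" "pcas y p x" for y p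
    using that
  proof (induction p arbitrary: y)
    case (Cons e p)
    then have "e \<in> parcs T" "fst e = y" "leads f {x} (snd e) x" by auto
    then have "y \<noteq> x" "snd e = f y" using arcs by auto
    then show ?case using \<open>leads f {x} (snd e) x\<close> by (simp add: leads_step_iff)
  qed (auto intro: leads.root)
  then have "\<forall>v\<in>pverts T. leads f {x} v x"
    using uniq unfolding awalk_with_proj_iff by blast
  moreover have ?wf using T by (simp add: tree_towards_def)
  ultimately show "?wf \<and> ?x \<and> ?f" using arcs x by blast
next
  assume "?wf \<and> ?x \<and> ?f"
  then obtain f where wf: ?wf and x: "x \<in> pverts T"
    and arcs: "parcs T = (\<lambda>v. (v, f v)) ` (pverts T - {x})"
    and leads: "\<And>v. v \<in> pverts T \<Longrightarrow> leads f {x} v x" by blast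
  interpret pair_wf_digraph T by (rule wf)
  have ex: "\<exists>p. set p \<subseteq> parcs T \<and> pcas v p \<rho>" if "leads f {x} v \<rho>" "v \<in> pverts T" for v \<rho>
    using that
  proof (induction rule: leads.induct)
    case (root \<rho>)
    have "set [] \<subseteq> parcs T \<and> pcas \<rho> [] \<rho>" by simp
    then show ?case by blast
  next
    case (step v \<rho>)
    then have arc: "(v, f v) \<in> parcs T" using arcs by auto
    then obtain p where "set p \<subseteq> parcs T" "pcas (f v) p \<rho>" using step in_arcsD2 by blast
    then have "set ((v, f v) # p) \<subseteq> parcs T \<and> pcas v ((v, f v) # p) \<rho>" using arc by simp
    then show ?case by blast
  qed
  \<comment> \<open>The first arcs of both walks have the same tail and so agree; a walk that has
    arrived at \<open>x\<close> must stop, since no arc leaves \<open>x\<close>.\<close>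
  have uniq: "p = q" if "set p \<subseteq> parcs T" "pcas v p x" "set q \<subseteq> parcs T" "pcas v q x" for v p q
    using that
  proof (induction p arbitrary: v q)
    case Nil
    then show ?case using arcs by (cases q) auto
  next
    case (Cons e p)
    then show ?case using arcs by (cases q) auto
  qed
  show "tree_towards T x"
    unfolding tree_towards_def awalk_with_proj_iff using wf x ex[OF leads] uniq by blast
qed

text \<open>For a single root the family of trees reduces to its value at \<open>x\<close>. This
  allows the encoding by maps to be carried out once, for forests.\<close>

lemma arborescences_eq_spanning_forests: "arborescences G x = spanning_forests G {x}"
proof -
  have *: "(\<exists>T. tree_towards (T x) x \<and> pverts H = pverts (T x) \<and> parcs H = parcs (T x)) \<longleftrightarrow>
      tree_towards H x" for H :: "'a pair_pre_digraph"
  proof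
    assume "\<exists>T. tree_towards (T x) x \<and> pverts H = pverts (T x) \<and> parcs H = parcs (T x)"
    then obtain T :: "'a \<Rightarrow> 'a pair_pre_digraph"
      where "tree_towards (T x) x" "pverts H = pverts (T x)" "parcs H = parcs (T x)" by blast
    moreover from this have "H = T x" by simp
    ultimately show "tree_towards H x" by simp
  qed auto
  then show ?thesis
    by (simp add: arborescences_def spanning_forests_def disjoint_family_on_def *)
qed

section \<open>Spanning forests as graphs of maps\<close>

definition map_graph :: "'v set \<Rightarrow> 'v set \<Rightarrow> ('v \<Rightarrow> 'v) \<Rightarrow> 'v pair_pre_digraph" where
  "map_graph V R f = \<lparr> pverts = V, parcs = (\<lambda>v. (v, f v)) ` (V - R) \<rparr>"

text \<open>The tree of a root \<open>w\<close> consists of the vertices that lead to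
  \<open>w\<close>. Every vertex leads to some root, and to only one, so these trees cover the graph
  and are disjoint.\<close>

lemma map_graph_in_spanning_forests:
  assumes G: "pair_wf_digraph G" and R: "R \<subseteq> pverts G"
    and f: "f \<in> forest_maps (pverts G) R" "\<And>v. v \<in> pverts G - R \<Longrightarrow> (v, f v) \<in> parcs G"
  shows "map_graph (pverts G) R f \<in> spanning_forests G R"
proof -
  let ?V = "pverts G"
  define T where "T w = \<lparr> pverts = {v \<in> ?V. leads f R v w},
    parcs = (\<lambda>v. (v, f v)) ` {v \<in> ?V - R. leads f R v w} \<rparr>" for w
  have fV: "v \<in> ?V - R \<Longrightarrow> f v \<in> ?V" and ex: "v \<in> ?V \<Longrightarrow> \<exists>\<rho>. leads f R v \<rho>" for v
    using f(1) by (auto simp: forest_maps_def)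
  \<comment> \<open>Before its end the path meets no root, in particular not \<open>\<rho>\<close>,
    so it may be stopped at \<open>\<rho>\<close> alone.\<close>
  have retarget: "leads f {\<rho>} v \<rho>" if "leads f R v \<rho>" for v \<rho>
    using that
  proof (induction rule: leads.induct)
    case (step v \<rho>)
    then have "v \<noteq> \<rho>" using leads_in_roots by fastforce
    then show ?case using step by (auto intro: leads.step)
  qed (auto intro: leads.root)
  have tree: "tree_towards (T w) w" if w: "w \<in> R" for w
  proof -
    have "pair_wf_digraph (T w)"
      by unfold_locales (auto simp: T_def fV leads_step_iff)
    moreover have "pverts (T w) - {w} = {v \<in> ?V - R. leads f R v w}"
      using w by (auto simp: T_def leads_root_iff)
    ultimately show ?thesis
      unfolding tree_towards_iff_leads using w R
      by (auto simp: T_def intro: leads.root retarget)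
  qed
  have "pair_wf_digraph (map_graph ?V R f)"
    by unfold_locales (auto simp: map_graph_def fV)
  then have "spanning (with_proj (map_graph ?V R f)) (with_proj G)"
    using f(2) G by (auto simp: spanning_def subgraph_def compatible_def wf_digraph_wp_iff map_graph_def)
  moreover have "disjoint_family_on (\<lambda>w. pverts (T w)) R"
    by (auto simp: disjoint_family_on_def T_def dest: leads_unique)
  moreover have "?V = (\<Union>w\<in>R. pverts (T w))"
    using ex leads_in_roots by (fastforce simp: T_def)
  moreover have "(\<lambda>v. (v, f v)) ` (?V - R) = (\<Union>w\<in>R. parcs (T w))"
    using ex leads_in_roots by (fastforce simp: T_def)
  ultimately show ?thesis
    unfolding spanning_forests_def using tree
    by (intro CollectI conjI exI[of _ T]) (simp_all add: map_graph_def)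
qed

text \<open>Each tree comes with its own map \<open>F w\<close>. Disjointness of the trees allows
  these to be glued, \<open>tr v\<close> being the root of the tree that contains
  \<open>v\<close>.\<close>

lemma spanning_forest_is_map_graph:
  assumes H: "H \<in> spanning_forests G R"
  shows "\<exists>f\<in>forest_maps (pverts G) R. (\<forall>v\<in>pverts G - R. (v, f v) \<in> parcs G) \<and>
    H = map_graph (pverts G) R f"
proof -
  let ?V = "pverts G"
  obtain T where span: "spanning (with_proj H) (with_proj G)"
    and T: "\<And>w. w \<in> R \<Longrightarrow> tree_towards (T w) w"
    and disj: "disjoint_family_on (\<lambda>w. pverts (T w)) R"
    and verts: "pverts H = (\<Union>w\<in>R. pverts (T w))"
    and arcs: "parcs H = (\<Union>w\<in>R. parcs (T w))"
    using H by (auto simp: spanning_forests_def)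
  have HV: "pverts H = ?V" and HE: "parcs H \<subseteq> parcs G"
    using span by (auto simp: spanning_def subgraph_def)
  have "\<forall>w\<in>R. \<exists>f. parcs (T w) = (\<lambda>v. (v, f v)) ` (pverts (T w) - {w}) \<and>
      (\<forall>v\<in>pverts (T w). leads f {w} v w)"
    using T by (simp add: tree_towards_iff_leads)
  then obtain F where
    F: "\<And>w. w \<in> R \<Longrightarrow> parcs (T w) = (\<lambda>v. (v, F w v)) ` (pverts (T w) - {w})"
    and leadsF: "\<And>w v. w \<in> R \<Longrightarrow> v \<in> pverts (T w) \<Longrightarrow> leads (F w) {w} v w"
    by metis
  have root: "w \<in> pverts (T w)" and wf: "pair_wf_digraph (T w)" if "w \<in> R" for w
    using T[OF that] by (auto simp: tree_towards_def)
  have same: "w = w'" if "w \<in> R" "w' \<in> R" "v \<in> pverts (T w)" "v \<in> pverts (T w')" for v w w'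
    using disj that by (auto simp: disjoint_family_on_def)
  define tr where "tr v = (THE w. w \<in> R \<and> v \<in> pverts (T w))" for v
  have tr: "tr v = w" if "w \<in> R" "v \<in> pverts (T w)" for v w
    unfolding tr_def using that same by blast
  define f where "f = restrict (\<lambda>v. F (tr v) v) (?V - R)"
  have f: "f v = F w v" and notR: "v \<in> ?V - R"
    if "w \<in> R" "v \<in> pverts (T w)" "v \<noteq> w" for v w
  proof -
    \<comment> \<open>A root lies in its own tree, so by disjointness \<open>T w\<close> contains no
      root other than \<open>w\<close>.\<close>
    show "v \<in> ?V - R" using that same root HV verts by blast
    then show "f v = F w v" using that by (simp add: f_def tr)
  qed
  have VR: "?V - R = (\<Union>w\<in>R. pverts (T w) - {w})"
  proof (intro equalityI subsetI)
    fix v assume "v \<in> ?V - R"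
    then show "v \<in> (\<Union>w\<in>R. pverts (T w) - {w})" using HV verts by blast
  qed (use notR in blast)
  have graph: "parcs H = (\<lambda>v. (v, f v)) ` (?V - R)"
  proof -
    have "parcs (T w) = (\<lambda>v. (v, f v)) ` (pverts (T w) - {w})" if "w \<in> R" for w
      unfolding F[OF that] using f that by (intro image_cong) auto
    then show ?thesis unfolding arcs VR by auto
  qed
  \<comment> \<open>Paths never leave their tree, so along them \<open>f\<close> agrees with
    \<open>F w\<close>.\<close>
  have stay: "F w v \<in> pverts (T w)" if "w \<in> R" "v \<in> pverts (T w) - {w}" for w v
    using pair_wf_digraph.in_arcsD2[OF wf[OF that(1)], of v "F w v"] F that by auto
  have "leads f R v \<rho>" if "leads (F w) {w} v \<rho>" "w \<in> R" "v \<in> pverts (T w)" for v w \<rho>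
    using that
  proof (induction rule: leads.induct)
    case (step v \<rho>)
    then have "leads f R (f v) \<rho>" "v \<notin> R" using stay f notR by auto
    then show ?case by (simp add: leads_step_iff)
  qed (auto intro: leads.root)
  then have "\<exists>\<rho>. leads f R v \<rho>" if "v \<in> ?V" for v
    using that leadsF verts HV by blast
  moreover have "f v \<in> ?V" if v: "v \<in> ?V - R" for v
  proof -
    obtain w where w: "w \<in> R" "v \<in> pverts (T w) - {w}" using v VR by blast
    then have "f v \<in> pverts (T w)" using stay[OF w] f by simp
    then show ?thesis using w(1) HV verts by blast
  qed
  ultimately have "f \<in> forest_maps ?V R"
    by (auto simp: forest_maps_def f_def)
  moreover have "H = map_graph ?V R f"
    using graph HV by (cases H) (simp add: map_graph_def)
  ultimately show ?thesis using graph HE by blast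
qed

text \<open>Maps that use a non-arc are included in \<open>forest_weight\<close> at weight zero.
  Here \<open>c\<close> is the extension by zero of the arc weights \<open>r\<close>, up to
  loops.\<close>

lemma weight_spanning_forests:
  assumes G: "pair_wf_digraph G" and fin: "finite (pverts G)" and R: "R \<subseteq> pverts G"
    and arc: "\<And>e. e \<in> parcs G \<Longrightarrow> c e = r e"
    and no_arc: "\<And>u v. u \<in> pverts G \<Longrightarrow> v \<in> pverts G \<Longrightarrow> u \<noteq> v \<Longrightarrow> (u, v) \<notin> parcs G \<Longrightarrow> c (u, v) = 0"
  shows "weight r (spanning_forests G R) = forest_weight c (pverts G) R"
proof -
  let ?V = "pverts G"
  let ?D = "{f \<in> forest_maps ?V R. \<forall>v\<in>?V - R. (v, f v) \<in> parcs G}"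
  have inj: "inj_on (map_graph ?V R) ?D"
  proof (rule inj_onI)
    fix f g assume fg: "f \<in> ?D" "g \<in> ?D" and "map_graph ?V R f = map_graph ?V R g"
    then have eq: "(\<lambda>v. (v, f v)) ` (?V - R) = (\<lambda>v. (v, g v)) ` (?V - R)"
      by (simp add: map_graph_def)
    show "f = g"
    proof (rule PiE_ext)
      show "f \<in> (?V - R) \<rightarrow>\<^sub>E ?V" "g \<in> (?V - R) \<rightarrow>\<^sub>E ?V"
        using fg by (auto simp: forest_maps_def)
      show "f v = g v" if "v \<in> ?V - R" for v
        using eq that by blast
    qed
  qed
  have "spanning_forests G R = map_graph ?V R ` ?D"
    using map_graph_in_spanning_forests[OF G R] spanning_forest_is_map_graph by fast
  then have "weight r (spanning_forests G R) = (\<Sum>f\<in>?D. \<Prod>e\<in>parcs (map_graph ?V R f). r e)"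
    by (simp add: weight_def sum.reindex[OF inj])
  also have "\<dots> = (\<Sum>f\<in>?D. map_weight c ?V R f)"
  proof (rule sum.cong[OF refl])
    fix f assume "f \<in> ?D"
    have "inj_on (\<lambda>v. (v, f v)) (?V - R)" by (auto intro: inj_onI)
    then show "(\<Prod>e\<in>parcs (map_graph ?V R f). r e) = map_weight c ?V R f"
      using \<open>f \<in> ?D\<close> by (simp add: map_graph_def map_weight_def prod.reindex arc)
  qed
  also have "\<dots> = forest_weight c ?V R"
    unfolding forest_weight_def
  proof (rule sum.mono_neutral_left)
    show "\<forall>f\<in>forest_maps ?V R - ?D. map_weight c ?V R f = 0"
    proof
      fix f assume f: "f \<in> forest_maps ?V R - ?D"
      then obtain v where v: "v \<in> ?V - R" "(v, f v) \<notin> parcs G" by blast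
      have "f v \<in> ?V" using f v by (auto simp: forest_maps_def)
      \<comment> \<open>A fixed point outside \<open>R\<close> would be a cycle, so loops do not
        occur in a forest.\<close>
      moreover have "f v \<noteq> v"
        using f v leads_no_cycle[of v R f] leads.root[of v "insert v R" f]
        by (auto simp: forest_maps_def)
      ultimately have "c (v, f v) = 0" using v no_arc by fastforce
      then show "map_weight c ?V R f = 0"
        using v fin unfolding map_weight_def by (intro prod_zero) auto
    qed
  qed (use fin in \<open>auto simp: finite_forest_maps\<close>)
  finally show ?thesis .
qed

section \<open>Harmonic functions and the reduction of forest weights\<close>

text \<open>Stated through closed sets, the form in which the maximum principle uses
  connectedness.\<close>

definition irreducible_on :: "'v set \<Rightarrow> ('v \<times> 'v \<Rightarrow> real) \<Rightarrow> bool" where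
  "irreducible_on V c \<longleftrightarrow>
     (\<forall>A\<subseteq>V. A \<noteq> {} \<longrightarrow> (\<forall>a\<in>A. \<forall>b\<in>V. c (a, b) > 0 \<longrightarrow> b \<in> A) \<longrightarrow> A = V)"

text \<open>The maximum principle: where a positive maximum is attained, harmonicity forces it on
  all points reached at positive rate. By irreducibility it is attained everywhere, also on
  \<open>R\<close>, where \<open>h\<close> is not positive.\<close>

lemma harmonic_nonpos:
  assumes V: "finite V" and R: "R \<subseteq> V" "R \<noteq> {}" and irr: "irreducible_on V c"
    and nonneg: "\<And>a b. a \<in> V \<Longrightarrow> b \<in> V \<Longrightarrow> c (a, b) \<ge> 0"
    and harm: "\<And>v. v \<in> V - R \<Longrightarrow> harmonic_at V c h v"
    and bdry: "\<And>v. v \<in> R \<Longrightarrow> h v \<le> 0"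
    and v: "v \<in> V"
  shows "h v \<le> 0"
proof (rule ccontr)
  assume neg: "\<not> h v \<le> 0"
  define m where "m = Max (h ` V)"
  have le: "h w \<le> m" if "w \<in> V" for w
    using that V by (simp add: m_def)
  then have m: "m > 0" using v neg by force
  have "m \<in> h ` V" using V v unfolding m_def by (intro Max_in) auto
  then have ne: "{w \<in> V. h w = m} \<noteq> {}" by auto
  have "h b = m" if ab: "a \<in> V" "h a = m" "b \<in> V" "c (a, b) > 0" for a b
  proof -
    have "a \<notin> R" using ab m bdry by fastforce
    then have "harmonic_at V c h a" using harm ab by blast
    then have "(\<Sum>w\<in>V. c (a, w) * (m - h w)) = 0"
      using ab(2) by (simp add: harmonic_at_def right_diff_distrib sum_subtractf)
    moreover have "\<forall>w\<in>V. c (a, w) * (m - h w) \<ge> 0"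
      using nonneg[OF ab(1)] le by simp
    ultimately have "c (a, b) * (m - h b) = 0"
      using V ab(3) by (simp add: sum_nonneg_eq_0_iff)
    then show ?thesis using ab(4) by simp
  qed
  then have "{w \<in> V. h w = m} = V"
    using irr ne unfolding irreducible_on_def by (metis (mono_tags, lifting) mem_Collect_eq subsetI)
  moreover obtain w where "w \<in> R" using R(2) by blast
  ultimately have "h w = m" using R(1) by blast
  then show False using bdry[OF \<open>w \<in> R\<close>] m by simp
qed

lemma harmonic_at_diff:
  "harmonic_at V c f v \<Longrightarrow> harmonic_at V c g v \<Longrightarrow> harmonic_at V c (\<lambda>w. f w - g w) v"
  unfolding harmonic_at_def right_diff_distrib sum_subtractf by linarith

lemma harmonic_at_sum:
  assumes "\<And>i. i \<in> I \<Longrightarrow> harmonic_at V c (h i) v"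
  shows "harmonic_at V c (\<lambda>w. \<Sum>i\<in>I. h i w * k i) v"
proof -
  have "(\<Sum>w\<in>V. c (v, w) * ((\<Sum>i\<in>I. h i w * k i) - (\<Sum>i\<in>I. h i v * k i))) =
      (\<Sum>w\<in>V. \<Sum>i\<in>I. k i * (c (v, w) * (h i w - h i v)))"
    unfolding sum_subtractf[symmetric] sum_distrib_left
    by (intro sum.cong refl) (simp add: algebra_simps)
  also have "\<dots> = (\<Sum>i\<in>I. k i * (\<Sum>w\<in>V. c (v, w) * (h i w - h i v)))"
    unfolding sum_distrib_left by (rule sum.swap)
  also have "\<dots> = 0"
    using assms by (simp add: harmonic_at_def)
  finally show ?thesis by (simp add: harmonic_at_def)
qed

lemma harmonic_unique:
  assumes "finite V" "R \<subseteq> V" "R \<noteq> {}" "irreducible_on V c"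
    and "\<And>a b. a \<in> V \<Longrightarrow> b \<in> V \<Longrightarrow> c (a, b) \<ge> 0"
    and "\<And>v. v \<in> V - R \<Longrightarrow> harmonic_at V c f v"
    and "\<And>v. v \<in> V - R \<Longrightarrow> harmonic_at V c g v"
    and "\<And>v. v \<in> R \<Longrightarrow> f v = g v" and "v \<in> V"
  shows "f v = g v"
proof -
  have "f v - g v \<le> 0"
    by (rule harmonic_nonpos[OF assms(1-5), where h = "\<lambda>w. f w - g w"])
      (use assms in \<open>auto intro: harmonic_at_diff\<close>)
  moreover have "g v - f v \<le> 0"
    by (rule harmonic_nonpos[OF assms(1-5), where h = "\<lambda>w. g w - f w"])
      (use assms in \<open>auto intro: harmonic_at_diff\<close>)
  ultimately show ?thesis by simp
qed

text \<open>The functions \<open>P _ y\<close> are the harmonic extensions of the point masses on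
  \<open>V'\<close>. Induction on \<open>card (V' - R)\<close>: both forest weights are expanded at
  a vertex \<open>u\<close> of \<open>V' - R\<close>, which leaves the comparison of
  \<open>h\<close> with the extension \<open>e\<close> of \<open>?a * h'\<close>. Both are harmonic
  off \<open>insert u R\<close> and agree on it by the induction hypothesis.\<close>

lemma forest_weight_reduction:
  assumes V: "finite V" and V': "V' \<subseteq> V" and irr: "irreducible_on V c"
    and nonneg: "\<And>a b. a \<in> V \<Longrightarrow> b \<in> V \<Longrightarrow> c (a, b) \<ge> 0"
    and bdry: "\<And>y w. y \<in> V' \<Longrightarrow> w \<in> V' \<Longrightarrow> P w y = of_bool (w = y)"
    and harm: "\<And>y z. y \<in> V' \<Longrightarrow> z \<in> V - V' \<Longrightarrow> harmonic_at V c (\<lambda>w. P w y) z"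
    and c': "\<And>x y. x \<in> V' \<Longrightarrow> y \<in> V' \<Longrightarrow> c' (x, y) = c (x, y) + (\<Sum>z\<in>V - V'. c (x, z) * P z y)"
    and R: "R \<subseteq> V'" "R \<noteq> {}"
  shows "forest_weight c V R = forest_weight c V V' * forest_weight c' V' R"
proof -
  note finV' = finite_subset[OF V' V]
  have at_bdry: "(\<Sum>y\<in>V'. P w y * k y) = k w" if "w \<in> V'" for w and k :: "'a \<Rightarrow> real"
  proof -
    have "(\<Sum>y\<in>V'. P w y * k y) = (\<Sum>y\<in>V'. if w = y then k y else 0)"
      using that by (intro sum.cong refl) (auto simp: bdry)
    then show ?thesis using that finV' by simp
  qed
  \<comment> \<open>The sum and the constant \<open>1\<close> are both harmonic off
    \<open>V'\<close> with boundary value \<open>1\<close>.\<close>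
  have total: "(\<Sum>y\<in>V'. P w y) = 1" if "w \<in> V" for w
  proof -
    have "(\<Sum>y\<in>V'. P w y * 1) = (\<lambda>_. 1) w"
    proof (rule harmonic_unique[OF V V' _ irr nonneg _ _ _ that])
      show "harmonic_at V c (\<lambda>w. \<Sum>y\<in>V'. P w y * 1) v" if "v \<in> V - V'" for v
        using that harm by (intro harmonic_at_sum) auto
    qed (use R at_bdry[of _ "\<lambda>_. 1"] in \<open>auto simp: harmonic_at_def\<close>)
    then show ?thesis by simp
  qed
  \<comment> \<open>At points of \<open>V'\<close>, the rates \<open>c\<close> act on the extension
    of \<open>k\<close> as the reduced rates act on \<open>k\<close>.\<close>
  have average: "(\<Sum>w\<in>V. c (u, w) * (\<Sum>y\<in>V'. P w y * k y)) = (\<Sum>y\<in>V'. c' (u, y) * k y)"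
    if u: "u \<in> V'" for u k
  proof -
    have "(\<Sum>y\<in>V'. c' (u, y) * k y) =
        (\<Sum>y\<in>V'. c (u, y) * k y) + (\<Sum>y\<in>V'. \<Sum>z\<in>V - V'. c (u, z) * (P z y * k y))"
      by (simp add: c'[OF u] distrib_right sum.distrib sum_distrib_right mult.assoc)
    also have "(\<Sum>y\<in>V'. \<Sum>z\<in>V - V'. c (u, z) * (P z y * k y)) =
        (\<Sum>z\<in>V - V'. c (u, z) * (\<Sum>y\<in>V'. P z y * k y))"
      unfolding sum_distrib_left by (rule sum.swap)
    also have "(\<Sum>y\<in>V'. c (u, y) * k y) = (\<Sum>w\<in>V'. c (u, w) * (\<Sum>y\<in>V'. P w y * k y))"
      by (intro sum.cong refl) (simp add: at_bdry)
    finally show ?thesis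
      using sum.subset_diff[OF V' V, of "\<lambda>w. c (u, w) * (\<Sum>y\<in>V'. P w y * k y)"] by simp
  qed
  show ?thesis using R
  proof (induction "card (V' - R)" arbitrary: R)
    case 0
    then have "R = V'" using finV' by auto
    then show ?case by (simp add: forest_weight_all_roots)
  next
    case (Suc n)
    have "V' - R \<noteq> {}" using Suc.hyps(2) by (metis card.empty nat.distinct(1))
    then obtain u where u: "u \<in> V' - R" by blast
    let ?R' = "insert u R"
    let ?a = "forest_weight c V V'"
    define h where "h = leads_weight c V ?R' R"
    define h' where "h' = leads_weight c' V' ?R' R"
    define e where "e w = (\<Sum>y\<in>V'. P w y * (?a * h' y))" for w
    have "V' - ?R' = (V' - R) - {u}" by auto
    then have "n = card (V' - ?R')" using Suc.hyps(2) u finV' by simp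
    then have IH: "forest_weight c V ?R' = ?a * forest_weight c' V' ?R'"
      using Suc.hyps(1)[of ?R'] Suc.prems u by auto
    have e_bdry: "e w = ?a * h' w" if "w \<in> V'" for w
      unfolding e_def using that by (rule at_bdry)
    have e_harm: "harmonic_at V c e z" if z: "z \<in> V - ?R'" for z
    proof (cases "z \<in> V'")
      case False
      then show ?thesis unfolding e_def using z harm by (intro harmonic_at_sum) auto
    next
      case True
      \<comment> \<open>By \<open>total\<close> the constant \<open>e z\<close> can be moved under
        the average over \<open>V'\<close>; then harmonicity of \<open>e\<close> for
        \<open>c\<close> becomes that of \<open>h'\<close> for \<open>c'\<close>.\<close>
      have "(\<Sum>w\<in>V. c (z, w) * (e w - e z)) =
          (\<Sum>w\<in>V. c (z, w) * (\<Sum>y\<in>V'. P w y * (?a * (h' y - h' z))))"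
      proof (intro sum.cong refl arg_cong2[where f = "(*)"])
        fix w assume "w \<in> V"
        have "(\<Sum>y\<in>V'. P w y * (?a * (h' y - h' z))) = e w - (\<Sum>y\<in>V'. P w y) * (?a * h' z)"
          unfolding e_def sum_distrib_right sum_subtractf[symmetric]
          by (simp add: right_diff_distrib)
        then show "e w - e z = (\<Sum>y\<in>V'. P w y * (?a * (h' y - h' z)))"
          using total[OF \<open>w \<in> V\<close>] e_bdry[OF True] by simp
      qed
      also have "\<dots> = (\<Sum>y\<in>V'. c' (z, y) * (?a * (h' y - h' z)))"
        by (rule average[OF True])
      also have "\<dots> = ?a * (\<Sum>y\<in>V'. c' (z, y) * (h' y - h' z))"
        by (simp add: sum_distrib_left mult.left_commute)
      also have "\<dots> = 0"
        using leads_weight_harmonic[of V' z ?R' R c'] finV' True z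
        by (auto simp: h'_def harmonic_at_def)
      finally show ?thesis by (simp add: harmonic_at_def)
    qed
    have h_eq: "h w = e w" if w: "w \<in> V" for w
    proof (rule harmonic_unique[OF V _ _ irr nonneg _ e_harm _ w, where R = ?R'])
      show "?R' \<subseteq> V" using Suc.prems u V' by auto
      show "harmonic_at V c h v" if "v \<in> V - ?R'" for v
        unfolding h_def using V that by (rule leads_weight_harmonic) auto
      \<comment> \<open>Both sides vanish at \<open>u\<close>; on \<open>R\<close> they are the two
        forest weights for \<open>?R'\<close>, related by \<open>IH\<close>.\<close>
      show "h v = e v" if "v \<in> ?R'" for v
      proof -
        have "v \<in> V'" using that Suc.prems u by auto
        then show ?thesis
          using that by (simp add: e_bdry h_def h'_def leads_weight_at_root IH)
      qed
    qed auto
    have "forest_weight c V R = (\<Sum>w\<in>V. c (u, w) * e w)"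
      using u V' V by (subst forest_weight_insert[of V u]) (auto simp: h_eq h_def[symmetric])
    also have "\<dots> = (\<Sum>y\<in>V'. c' (u, y) * (?a * h' y))"
      unfolding e_def using u by (intro average) auto
    also have "\<dots> = ?a * forest_weight c' V' R"
      using u finV' by (subst forest_weight_insert[of V' u])
        (auto simp: h'_def sum_distrib_left mult.left_commute)
    finally show ?case .
  qed
qed

section \<open>First-entry probabilities\<close>

text \<open>A Gronwall argument: for fixed \<open>y\<close>, the sum \<open>E\<close> of the squared
  differences satisfies \<open>E' \<le> K * E\<close> and \<open>E 0 = 0\<close>, so
  \<open>E s * exp (- K * s)\<close> does not increase from \<open>0\<close>.\<close>

lemma transition_function_unique:
  assumes V: "finite V" and p: "transition_function V q p" and p': "transition_function V q p'"
    and t: "t \<ge> 0" and x: "x \<in> V" and y: "y \<in> V"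
  shows "p t x y = p' t x y"
proof -
  define d where "d s u = p s u y - p' s u y" for s u
  define E where "E s = (\<Sum>u\<in>V. (d s u)\<^sup>2)" for s
  \<comment> \<open>The constant results from bounding each product \<open>d s u * d s w\<close> by
    \<open>E s\<close>.\<close>
  define K where "K = (\<Sum>u\<in>V. \<Sum>w\<in>V. 2 * \<bar>q u w\<bar>)"
  have d': "((\<lambda>s. d s u) has_real_derivative (\<Sum>w\<in>V. q u w * d s w)) (at s within {0..})"
    if "u \<in> V" "s \<ge> 0" for u s
  proof -
    have "((\<lambda>s. p s u y - p' s u y) has_real_derivative
        (\<Sum>w\<in>V. q u w * p s w y) - (\<Sum>w\<in>V. q u w * p' s w y)) (at s within {0..})"
      using p p' that y by (intro DERIV_diff) (auto simp: transition_function_def)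
    then show ?thesis
      by (simp add: d_def sum_subtractf right_diff_distrib)
  qed
  define E' where "E' s = (\<Sum>u\<in>V. 2 * d s u * (\<Sum>w\<in>V. q u w * d s w))" for s
  have derE: "(E has_real_derivative E' s) (at s within {0..})" if "s \<ge> 0" for s
    unfolding E_def E'_def
  proof (rule DERIV_sum)
    fix u assume "u \<in> V"
    then show "((\<lambda>s. (d s u)\<^sup>2) has_real_derivative 2 * d s u * (\<Sum>w\<in>V. q u w * d s w))
        (at s within {0..})"
      using DERIV_power[OF d'[OF _ that], of u 2] by (simp add: mult_ac)
  qed
  have growth: "E' s \<le> K * E s" for s
  proof -
    have "2 * d s u * (q u w * d s w) \<le> 2 * \<bar>q u w\<bar> * E s" if "u \<in> V" "w \<in> V" for u w
    proof -
      have le: "(d s u)\<^sup>2 \<le> E s" if "u \<in> V" for u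
        unfolding E_def using V that by (intro member_le_sum) auto
      have "2 * \<bar>d s u * d s w\<bar> \<le> (d s u)\<^sup>2 + (d s w)\<^sup>2"
        using sum_squares_bound[of "\<bar>d s u\<bar>" "\<bar>d s w\<bar>"] by (simp add: abs_mult)
      then have "\<bar>d s u * d s w\<bar> \<le> E s" using le[OF \<open>u \<in> V\<close>] le[OF \<open>w \<in> V\<close>] by linarith
      then have "\<bar>q u w\<bar> * \<bar>d s u * d s w\<bar> \<le> \<bar>q u w\<bar> * E s" by (intro mult_left_mono) auto
      moreover have "q u w * (d s u * d s w) \<le> \<bar>q u w\<bar> * \<bar>d s u * d s w\<bar>"
        using abs_ge_self[of "q u w * (d s u * d s w)"] by (simp add: abs_mult)
      ultimately show ?thesis by (simp add: mult_ac)
    qed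
    then show ?thesis
      unfolding E'_def K_def sum_distrib_left sum_distrib_right by (intro sum_mono) auto
  qed
  let ?F = "\<lambda>s. E s * exp (- K * s)"
  have derF: "(?F has_real_derivative (E' s - K * E s) * exp (- K * s)) (at s within {0..})"
    if "s \<ge> 0" for s
    by (rule derivative_eq_intros derE that refl | simp add: algebra_simps)+
  have "?F t \<le> ?F 0"
  proof (rule DERIV_nonpos_imp_decreasing_open[OF t])
    fix s assume s: "0 < s" "s < t"
    have "(?F has_real_derivative (E' s - K * E s) * exp (- K * s)) (at s)"
      using derF[of s] s at_within_interior[of s "{0..}"] by simp
    moreover have "(E' s - K * E s) * exp (- K * s) \<le> 0"
      using growth[of s] by (simp add: mult_le_0_iff)
    ultimately show "\<exists>z. (?F has_real_derivative z) (at s) \<and> z \<le> 0" by blast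
  next
    have "continuous_on {0..} ?F"
      using derF by (intro DERIV_continuous_on) auto
    then show "continuous_on {0..t} ?F"
      by (rule continuous_on_subset) auto
  qed
  moreover have "E 0 = 0"
    using p p' y by (auto simp: E_def d_def transition_function_def)
  ultimately have "E t \<le> 0" by (simp add: mult_le_0_iff)
  moreover have "(d t x)\<^sup>2 \<le> E t"
    unfolding E_def using V x by (intro member_le_sum) auto
  ultimately have "(d t x)\<^sup>2 \<le> 0" by linarith
  then show ?thesis by (simp add: d_def)
qed

section \<open>Entry probabilities of discrete-time chains\<close>

text \<open>For the chain with one-step matrix \<open>P\<close> started at \<open>w\<close>, this is
  the probability to avoid \<open>A\<close> before time \<open>n\<close> and to be at
  \<open>y\<close> at time \<open>n\<close>, computed by conditioning on the first step.\<close>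

primrec visit_prob :: "'v set \<Rightarrow> 'v set \<Rightarrow> ('v \<Rightarrow> 'v \<Rightarrow> real) \<Rightarrow> 'v \<Rightarrow> nat \<Rightarrow> 'v \<Rightarrow> real" where
  "visit_prob V A P y 0 w = of_bool (w = y)"
| "visit_prob V A P y (Suc n) w =
     (if w \<in> A then 0 else \<Sum>w'\<in>V. P w w' * visit_prob V A P y n w')"

definition entry_prob :: "'v set \<Rightarrow> 'v set \<Rightarrow> ('v \<Rightarrow> 'v \<Rightarrow> real) \<Rightarrow> 'v \<Rightarrow> 'v \<Rightarrow> real" where
  "entry_prob V A P y w = (\<Sum>n. visit_prob V A P y n w)"

lemma entry_prob_in:
  assumes "w \<in> A" shows "entry_prob V A P y w = of_bool (w = y)"
proof -
  have "visit_prob V A P y n w = 0" if "n \<notin> {0}" for n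
    using assms that by (cases n) auto
  then show ?thesis
    unfolding entry_prob_def by (subst suminf_finite[of "{0}"]) auto
qed

text \<open>First-step analysis: the summand for time \<open>0\<close> vanishes, since
  \<open>y\<close> is in \<open>A\<close> and \<open>w\<close> is not.\<close>

lemma entry_prob_step:
  assumes V: "finite V" and y: "y \<in> A" and w: "w \<in> V - A"
    and summ: "\<And>w. w \<in> V \<Longrightarrow> summable (\<lambda>n. visit_prob V A P y n w)"
  shows "entry_prob V A P y w = (\<Sum>w'\<in>V. P w w' * entry_prob V A P y w')"
proof -
  have "entry_prob V A P y w = (\<Sum>n. visit_prob V A P y (Suc n) w)"
    unfolding entry_prob_def using summ[of w] w y by (subst suminf_split_head) auto
  also have "\<dots> = (\<Sum>n. \<Sum>w'\<in>V. P w w' * visit_prob V A P y n w')"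
    using w by simp
  also have "\<dots> = (\<Sum>w'\<in>V. \<Sum>n. P w w' * visit_prob V A P y n w')"
    using summ by (intro suminf_sum summable_mult)
  also have "\<dots> = (\<Sum>w'\<in>V. P w w' * entry_prob V A P y w')"
    unfolding entry_prob_def using summ by (intro sum.cong refl suminf_mult)
  finally show ?thesis .
qed

text \<open>The Markov property is available only for complete initial segments
  \<open>s 0, ..., s m\<close>. So the claim is generalized to paths with such a prescribed segment,
  and the induction on \<open>n\<close> extends the segment by one state.\<close>

lemma (in prob_space) visit_prob_eq:
  fixes Y :: "nat \<Rightarrow> 'a \<Rightarrow> 'v"
  assumes V: "finite V" and Y: "\<And>i. Y i \<in> measurable M (count_space V)"
    and markov: "\<And>n s. (\<And>i. i \<le> Suc n \<Longrightarrow> s i \<in> V) \<Longrightarrow>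
      prob {\<omega>\<in>space M. \<forall>i\<le>Suc n. Y i \<omega> = s i} =
      prob {\<omega>\<in>space M. \<forall>i\<le>n. Y i \<omega> = s i} * P (s n) (s (Suc n))"
    and z: "z \<in> V" and start: "AE \<omega> in M. Y 0 \<omega> = z"
  shows "prob {\<omega>\<in>space M. (\<forall>i<n. Y i \<omega> \<notin> A) \<and> Y n \<omega> = y} = visit_prob V A P y n z"
proof -
  have [measurable]: "Measurable.pred M (\<lambda>\<omega>. Q (Y i \<omega>))" for Q i
    using Y by (rule measurable_compose) simp
  have gen: "prob {\<omega>\<in>space M. (\<forall>i\<le>m. Y i \<omega> = s i) \<and>
        (\<forall>i. m \<le> i \<and> i < m + n \<longrightarrow> Y i \<omega> \<notin> A) \<and> Y (m + n) \<omega> = y} =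
      prob {\<omega>\<in>space M. \<forall>i\<le>m. Y i \<omega> = s i} * visit_prob V A P y n (s m)"
    (is "prob (?C m s n) = prob (?B m s) * _")
    if "\<And>i. i \<le> m \<Longrightarrow> s i \<in> V" for m s n
    using that
  proof (induction n arbitrary: m s)
    case 0
    show ?case
    proof (cases "s m = y")
      case True
      then have "?C m s 0 = ?B m s" by auto
      then show ?thesis using True by simp
    next
      case False
      then have "?C m s 0 = {}" by auto
      then show ?thesis using False by (simp only: measure_empty) simp
    qed
  next
    case (Suc n)
    show ?case
    proof (cases "s m \<in> A")
      case True
      then have "?C m s (Suc n) = {}" by fastforce
      then show ?thesis using True by (simp only: measure_empty) simp
    next
      case False
      let ?s = "\<lambda>w. s(Suc m := w)"
      have upto: "(\<forall>i\<le>Suc m. Y i \<omega> = ?s w i) \<longleftrightarrow> (\<forall>i\<le>m. Y i \<omega> = s i) \<and> Y (Suc m) \<omega> = w" for \<omega> w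
        by (auto simp: le_Suc_eq)
      have avoid: "(\<forall>i. m \<le> i \<and> i < m + Suc n \<longrightarrow> Y i \<omega> \<notin> A) \<longleftrightarrow>
          Y m \<omega> \<notin> A \<and> (\<forall>i. Suc m \<le> i \<and> i < Suc m + n \<longrightarrow> Y i \<omega> \<notin> A)" for \<omega>
      proof -
        have "m \<le> i \<and> i < m + Suc n \<longleftrightarrow> i = m \<or> Suc m \<le> i \<and> i < Suc m + n" for i by auto
        then show ?thesis by (simp only: imp_disjL all_conj_distrib simp_thms)
      qed
      have inV: "\<omega> \<in> space M \<Longrightarrow> Y i \<omega> \<in> V" for i \<omega>
        using measurable_space[OF Y] by simp
      \<comment> \<open>The event is split according to the state at time
        \<open>Suc m\<close>.\<close>
      have split: "?C m s (Suc n) = (\<Union>w\<in>V. ?C (Suc m) (?s w) n)"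
        unfolding upto avoid using False inV by auto
      have "prob (?C m s (Suc n)) = (\<Sum>w\<in>V. prob (?C (Suc m) (?s w) n))"
        unfolding split
      proof (rule finite_measure_finite_Union[OF V])
        show "disjoint_family_on (\<lambda>w. ?C (Suc m) (?s w) n) V"
          unfolding upto disjoint_family_on_def by auto
        show "(\<lambda>w. ?C (Suc m) (?s w) n) ` V \<subseteq> events" by auto
      qed
      also have "\<dots> = (\<Sum>w\<in>V. prob (?B (Suc m) (?s w)) * visit_prob V A P y n w)"
      proof (intro sum.cong refl)
        fix w assume "w \<in> V"
        then have "\<And>i. i \<le> Suc m \<Longrightarrow> ?s w i \<in> V" using Suc.prems by (auto simp: le_Suc_eq)
        then show "prob (?C (Suc m) (?s w) n) = prob (?B (Suc m) (?s w)) * visit_prob V A P y n w"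
          using Suc.IH[of "Suc m" "?s w"] by (simp only: fun_upd_same)
      qed
      also have "\<dots> = (\<Sum>w\<in>V. prob (?B m s) * P (s m) w * visit_prob V A P y n w)"
      proof (intro sum.cong refl)
        fix w assume "w \<in> V"
        then have "\<And>i. i \<le> Suc m \<Longrightarrow> ?s w i \<in> V" using Suc.prems by (auto simp: le_Suc_eq)
        moreover have "?s w m = s m" by simp
        ultimately have "prob (?B (Suc m) (?s w)) = prob (?B m (?s w)) * P (s m) w"
          using markov[of m "?s w"] by (simp only: fun_upd_same)
        moreover have "?B m (?s w) = ?B m s" by auto
        ultimately show "prob (?B (Suc m) (?s w)) * visit_prob V A P y n w =
            prob (?B m s) * P (s m) w * visit_prob V A P y n w" by simp
      qed
      also have "\<dots> = prob (?B m s) * visit_prob V A P y (Suc n) (s m)"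
        using False by (simp add: sum_distrib_left mult.assoc)
      finally show ?thesis .
    qed
  qed
  have "prob {\<omega>\<in>space M. (\<forall>i<n. Y i \<omega> \<notin> A) \<and> Y n \<omega> = y} =
      prob {\<omega>\<in>space M. (\<forall>i\<le>0. Y i \<omega> = z) \<and>
        (\<forall>i. 0 \<le> i \<and> i < 0 + n \<longrightarrow> Y i \<omega> \<notin> A) \<and> Y (0 + n) \<omega> = y}"
    using start by (intro finite_measure_eq_AE) auto
  also have "\<dots> = prob {\<omega>\<in>space M. \<forall>i\<le>0. Y i \<omega> = z} * visit_prob V A P y n z"
    using gen[of 0 "\<lambda>_. z" n] z by simp
  also have "prob {\<omega>\<in>space M. \<forall>i\<le>0. Y i \<omega> = z} = 1"
    using start by (subst prob_Collect_eq_1) auto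
  finally show ?thesis by simp
qed

text \<open>The events for different times are disjoint: a visit to \<open>y\<close>, which is in
  \<open>A\<close>, rules out that \<open>A\<close> is avoided until later.\<close>

lemma (in prob_space) entry_prob_sums:
  fixes Y :: "nat \<Rightarrow> 'a \<Rightarrow> 'v"
  assumes V: "finite V" and Y: "\<And>i. Y i \<in> measurable M (count_space V)"
    and markov: "\<And>n s. (\<And>i. i \<le> Suc n \<Longrightarrow> s i \<in> V) \<Longrightarrow>
      prob {\<omega>\<in>space M. \<forall>i\<le>Suc n. Y i \<omega> = s i} =
      prob {\<omega>\<in>space M. \<forall>i\<le>n. Y i \<omega> = s i} * P (s n) (s (Suc n))"
    and z: "z \<in> V" and start: "AE \<omega> in M. Y 0 \<omega> = z" and y: "y \<in> A"
  shows "(\<lambda>n. visit_prob V A P y n z) sums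
    prob {\<omega>\<in>space M. \<exists>n. (\<forall>i<n. Y i \<omega> \<notin> A) \<and> Y n \<omega> = y}"
proof -
  have [measurable]: "Measurable.pred M (\<lambda>\<omega>. Q (Y i \<omega>))" for Q i
    using Y by (rule measurable_compose) simp
  let ?H = "\<lambda>n. {\<omega>\<in>space M. (\<forall>i<n. Y i \<omega> \<notin> A) \<and> Y n \<omega> = y}"
  have "(\<lambda>n. prob (?H n)) sums prob (\<Union>n. ?H n)"
  proof (rule finite_measure_UNION)
    show "range ?H \<subseteq> events" by auto
    show "disjoint_family ?H"
      unfolding disjoint_family_on_def
    proof (intro ballI impI)
      fix m n :: nat assume "m \<noteq> n"
      then show "?H m \<inter> ?H n = {}" using y by (cases m n rule: linorder_cases) auto
    qed
  qed
  moreover have "(\<Union>n. ?H n) = {\<omega>\<in>space M. \<exists>n. (\<forall>i<n. Y i \<omega> \<notin> A) \<and> Y n \<omega> = y}" by auto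
  ultimately show ?thesis
    using visit_prob_eq[OF assms(1-5)] by simp
qed

text \<open>At the entry time a right-continuous path already sits in \<open>A\<close> and stays there for a while,
  so every fine enough skeleton enters \<open>A\<close> at the same point.\<close>

lemma skeleton_entry:
  fixes \<xi> :: "real \<Rightarrow> 'v"
  assumes right: "\<And>t. t \<ge> 0 \<Longrightarrow> \<forall>\<^sub>F s in at_right t. \<xi> s = \<xi> t" and y: "y \<in> A"
  shows "\<forall>\<^sub>F \<delta> in at_right 0.
    (\<exists>n. (\<forall>i<n. \<xi> (real i * \<delta>) \<notin> A) \<and> \<xi> (real n * \<delta>) = y) \<longleftrightarrow>
    (\<exists>t\<ge>0. \<xi> t \<in> A \<and> \<xi> t = y \<and> (\<forall>s. 0 \<le> s \<and> s < t \<longrightarrow> \<xi> s \<notin> A))"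
proof (cases "\<exists>t\<ge>0. \<xi> t \<in> A")
  case False
  have "\<not> (\<exists>n. (\<forall>i<n. \<xi> (real i * \<delta>) \<notin> A) \<and> \<xi> (real n * \<delta>) = y)" if "\<delta> > 0" for \<delta>
    using False y that by (metis mult_nonneg_nonneg of_nat_0_le_iff less_imp_le)
  then show ?thesis
    using False by (auto simp: eventually_at_right_field intro!: exI[of _ 1])
next
  case True
  define H where "H = {t. t \<ge> 0 \<and> \<xi> t \<in> A}"
  define \<tau> where "\<tau> = Inf H"
  have ne: "H \<noteq> {}" and bdd: "bdd_below H" using True by (auto simp: H_def)
  have \<tau>0: "\<tau> \<ge> 0" unfolding \<tau>_def using ne by (intro cInf_greatest) (auto simp: H_def)
  have before: "\<xi> s \<notin> A" if "0 \<le> s" "s < \<tau>" for s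
    using that cInf_lower[OF _ bdd, of s] by (force simp: \<tau>_def H_def)
  obtain b where b: "b > \<tau>" "\<And>s. \<tau> < s \<Longrightarrow> s < b \<Longrightarrow> \<xi> s = \<xi> \<tau>"
    using right[OF \<tau>0] unfolding eventually_at_right_field by blast
  then have stay: "\<xi> s = \<xi> \<tau>" if "\<tau> \<le> s" "s < b" for s
    using that by (cases "s = \<tau>") auto
  \<comment> \<open>The infimum is attained: \<open>H\<close> has points arbitrarily close to
    \<open>\<tau>\<close> from the right, where the path is constant.\<close>
  obtain t where t: "t \<in> H" "t < b"
    using cInf_lessD[OF ne, of b] b(1) by (auto simp: \<tau>_def)
  moreover have "\<tau> \<le> t" unfolding \<tau>_def by (rule cInf_lower[OF t(1) bdd])
  ultimately have \<tau>A: "\<xi> \<tau> \<in> A" using stay[of t] by (simp add: H_def)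
  have R: "(\<exists>t\<ge>0. \<xi> t \<in> A \<and> \<xi> t = y \<and> (\<forall>s. 0 \<le> s \<and> s < t \<longrightarrow> \<xi> s \<notin> A)) \<longleftrightarrow> \<xi> \<tau> = y"
    using before \<tau>A \<tau>0 by (metis linorder_neqE_linordered_idom)
  have "(\<exists>n. (\<forall>i<n. \<xi> (real i * \<delta>) \<notin> A) \<and> \<xi> (real n * \<delta>) = y) \<longleftrightarrow> \<xi> \<tau> = y"
    if \<delta>: "0 < \<delta>" "\<delta> < b - \<tau>" for \<delta>
  proof -
    \<comment> \<open>The first grid point at or after \<open>\<tau>\<close>; the mesh is smaller
      than \<open>b - \<tau>\<close>, so it falls into the interval of constancy.\<close>
    define n where "n = nat \<lceil>\<tau> / \<delta>\<rceil>"
    have rn: "real n = of_int \<lceil>\<tau> / \<delta>\<rceil>" using \<tau>0 \<delta> by (simp add: n_def)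
    have "\<tau> / \<delta> \<le> real n" "real n < \<tau> / \<delta> + 1" unfolding rn by linarith+
    then have n: "\<tau> \<le> real n * \<delta>" "real n * \<delta> < \<tau> + \<delta>"
      using \<delta> by (simp_all add: field_simps)
    have \<xi>n: "\<xi> (real n * \<delta>) = \<xi> \<tau>" using n \<delta> by (intro stay) auto
    have less: "\<xi> (real i * \<delta>) \<notin> A" if "i < n" for i
    proof (rule before)
      have "real i + 1 \<le> real n" using that by linarith
      then have "(real i + 1) * \<delta> \<le> real n * \<delta>" using \<delta> by (intro mult_right_mono) auto
      then show "real i * \<delta> < \<tau>" using n by (simp add: distrib_right)
    qed (use \<delta> in auto)
    have "m = n" if "\<forall>i<m. \<xi> (real i * \<delta>) \<notin> A" "\<xi> (real m * \<delta>) = y" for m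
      using that less \<xi>n \<tau>A y by (metis linorder_neqE_nat)
    then show ?thesis using less \<xi>n by metis
  qed
  then show ?thesis
    unfolding R eventually_at_right_field using b(1) by (intro exI[of _ "b - \<tau>"]) auto
qed

section \<open>From skeletons to the continuous-time chain\<close>

text \<open>Every law comes with a transition function of its own; by uniqueness the given
  \<open>p\<close> serves for all starting points at once.\<close>

lemma ctmc_skeleton:
  assumes X: "ctmc M X V c z" and p: "transition_function V (generator V c) p" and V: "finite V"
    and \<delta>: "\<delta> \<ge> 0" and s: "\<And>i. i \<le> Suc n \<Longrightarrow> s i \<in> V"
  shows "measure M {\<omega>\<in>space M. \<forall>i\<le>Suc n. X (real i * \<delta>) \<omega> = s i} =
    measure M {\<omega>\<in>space M. \<forall>i\<le>n. X (real i * \<delta>) \<omega> = s i} * p \<delta> (s n) (s (Suc n))"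
proof -
  obtain p' where p': "transition_function V (generator V c) p'"
    and markov: "\<forall>n. \<forall>t :: nat \<Rightarrow> real. \<forall>s :: nat \<Rightarrow> 'b.
      0 \<le> t 0 \<longrightarrow> (\<forall>i\<le>n. t i \<le> t (Suc i)) \<longrightarrow> (\<forall>i\<le>Suc n. s i \<in> V) \<longrightarrow>
      measure M {\<omega>\<in>space M. \<forall>i\<le>Suc n. X (t i) \<omega> = s i} =
      measure M {\<omega>\<in>space M. \<forall>i\<le>n. X (t i) \<omega> = s i} * p' (t (Suc n) - t n) (s n) (s (Suc n))"
    using X unfolding ctmc_def by blast
  have "p' \<delta> (s n) (s (Suc n)) = p \<delta> (s n) (s (Suc n))"
    using s by (intro transition_function_unique[OF V p' p \<delta>]) auto
  then show ?thesis
    using markov[THEN spec[of _ n], THEN spec[of _ "\<lambda>i. real i * \<delta>"], THEN spec[of _ s]] \<delta> s by (simp add: algebra_simps)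
qed

lemma
  assumes X: "ctmc M X V c z" and p: "transition_function V (generator V c) p" and V: "finite V"
    and \<delta>: "\<delta> \<ge> 0" and z: "z \<in> V" and y: "y \<in> A"
  shows summable_visit_prob: "summable (\<lambda>n. visit_prob V A (p \<delta>) y n z)"
    and entry_prob_eq: "entry_prob V A (p \<delta>) y z =
      measure M {\<omega>\<in>space M. \<exists>n. (\<forall>i<n. X (real i * \<delta>) \<omega> \<notin> A) \<and> X (real n * \<delta>) \<omega> = y}"
proof -
  interpret prob_space M using X by (simp add: ctmc_def)
  have "X (real i * \<delta>) \<in> measurable M (count_space V)" for i
    using X \<delta> by (simp add: ctmc_def)
  moreover have "AE \<omega> in M. X (real 0 * \<delta>) \<omega> = z" using X by (simp add: ctmc_def)
  ultimately have "(\<lambda>n. visit_prob V A (p \<delta>) y n z) sums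
      measure M {\<omega>\<in>space M. \<exists>n. (\<forall>i<n. X (real i * \<delta>) \<omega> \<notin> A) \<and> X (real n * \<delta>) \<omega> = y}"
    using ctmc_skeleton[OF X p V \<delta>] z y
    by (intro entry_prob_sums[where Y = "\<lambda>i. X (real i * \<delta>)"] V) auto
  then show "summable (\<lambda>n. visit_prob V A (p \<delta>) y n z)"
    and "entry_prob V A (p \<delta>) y z =
      measure M {\<omega>\<in>space M. \<exists>n. (\<forall>i<n. X (real i * \<delta>) \<omega> \<notin> A) \<and> X (real n * \<delta>) \<omega> = y}"
    by (auto simp: entry_prob_def sums_iff)
qed

text \<open>On each path the skeleton and the chain eventually agree on whether \<open>A\<close> is
  entered at \<open>y\<close>, so the indicators converge pointwise and dominated convergence
  applies.\<close>

lemma entry_prob_tendsto: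
  assumes X: "ctmc M X V c z" and p: "transition_function V (generator V c) p" and V: "finite V"
    and z: "z \<in> V" and y: "y \<in> A"
    and \<delta>: "\<And>k. \<delta> k > 0" "\<delta> \<longlonglongrightarrow> 0"
  shows "(\<lambda>k. entry_prob V A (p (\<delta> k)) y z) \<longlonglongrightarrow> first_entry_prob M X A y"
proof -
  interpret prob_space M using X by (simp add: ctmc_def)
  define H where
    "H k = {\<omega>\<in>space M. \<exists>n. (\<forall>i<n. X (real i * \<delta> k) \<omega> \<notin> A) \<and> X (real n * \<delta> k) \<omega> = y}" for k
  define H' where "H' = {\<omega>\<in>space M. \<exists>t\<ge>0. X t \<omega> \<in> A \<and> X t \<omega> = y \<and>
    (\<forall>s. 0 \<le> s \<and> s < t \<longrightarrow> X s \<omega> \<notin> A)}"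
  have [measurable]: "Measurable.pred M (\<lambda>\<omega>. Q (X (real i * \<delta> k) \<omega>))" for Q i k
  proof -
    have "X (real i * \<delta> k) \<in> measurable M (count_space V)"
      using X \<delta>(1)[of k] by (simp add: ctmc_def)
    then show ?thesis by (rule measurable_compose) simp
  qed
  have H[measurable]: "H k \<in> events" for k unfolding H_def by measurable
  have "\<delta> k \<noteq> 0" for k using \<delta>(1)[of k] by simp
  then have "filterlim \<delta> (at_right 0) sequentially"
    using \<delta> by (simp add: filterlim_at)
  then have "\<forall>\<^sub>F k in sequentially. \<omega> \<in> H k \<longleftrightarrow> \<omega> \<in> H'" if "\<omega> \<in> space M" for \<omega>
    using skeleton_entry[of "\<lambda>t. X t \<omega>" y A] y X that
    unfolding H_def H'_def ctmc_def by (auto simp: filterlim_iff)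
  then have lim: "(\<lambda>k. indicator (H k) \<omega> :: real) \<longlonglongrightarrow> indicator H' \<omega>"
    if "\<omega> \<in> space M" for \<omega>
    using that by (intro tendsto_eventually) (force simp: indicator_def elim: eventually_mono)
  have "(\<lambda>k. integral\<^sup>L M (indicator (H k) :: _ \<Rightarrow> real)) \<longlonglongrightarrow> integral\<^sup>L M (indicator H')"
  proof (rule integral_dominated_convergence[where w = "\<lambda>_. 1"])
    \<comment> \<open>The event \<open>H'\<close> involves uncountably many times; its measurability
      comes from being a limit of skeleton events.\<close>
    show "(indicator H' :: _ \<Rightarrow> real) \<in> borel_measurable M"
      by (rule borel_measurable_LIMSEQ_real[OF lim]) auto
  qed (use lim in \<open>auto simp: indicator_def\<close>)
  moreover have "H k \<inter> space M = H k" "H' \<inter> space M = H'" for k by (auto simp: H_def H'_def)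
  ultimately have "(\<lambda>k. prob (H k)) \<longlonglongrightarrow> prob H'" by simp
  then show ?thesis
    using \<delta>(1) entry_prob_eq[OF X p V _ z y] by (simp add: less_imp_le H_def H'_def first_entry_prob_def)
qed

context
  fixes M :: "'v \<Rightarrow> 'w measure" and X :: "real \<Rightarrow> 'w \<Rightarrow> 'v" and V A :: "'v set" and c y
  assumes V: "finite V" and X: "\<And>z. z \<in> V \<Longrightarrow> ctmc (M z) X V c z" and y: "y \<in> A"
begin

text \<open>The skeletons have this entry probability for every mesh, hence so does the
  limit.\<close>

lemma first_entry_prob_in:
  assumes "z \<in> V" "z \<in> A"
  shows "first_entry_prob (M z) X A y = of_bool (z = y)"
proof -
  obtain p where "transition_function V (generator V c) p"
    using X[OF assms(1)] by (auto simp: ctmc_def)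
  from entry_prob_tendsto[OF X[OF assms(1)] this V assms(1) y, of "\<lambda>k. inverse (real (Suc k))"]
  have "(\<lambda>k. of_bool (z = y)) \<longlonglongrightarrow> first_entry_prob (M z) X A y"
    using LIMSEQ_inverse_real_of_nat by (simp add: entry_prob_in assms(2))
  then show ?thesis by (simp add: LIMSEQ_const_iff)
qed

lemma first_entry_prob_harmonic:
  assumes z: "z \<in> V - A"
  shows "harmonic_at V c (\<lambda>w. first_entry_prob (M w) X A y) z"
proof -
  let ?q = "generator V c" and ?h = "\<lambda>w. first_entry_prob (M w) X A y"
  let ?\<delta> = "\<lambda>k. inverse (real (Suc k))"
  obtain p where p: "transition_function V ?q p"
    using X[of z] z by (auto simp: ctmc_def)
  have \<delta>0: "?\<delta> \<longlonglongrightarrow> 0" by (rule LIMSEQ_inverse_real_of_nat)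
  have h: "(\<lambda>k. entry_prob V A (p (?\<delta> k)) y w) \<longlonglongrightarrow> ?h w" if "w \<in> V" for w
    by (rule entry_prob_tendsto[OF X[OF that] p V that y _ \<delta>0]) simp
  \<comment> \<open>The backward equation at time \<open>0\<close>, where \<open>p\<close> is the
    identity.\<close>
  have slope: "(\<lambda>k. (p (?\<delta> k) z w - of_bool (z = w)) / ?\<delta> k) \<longlonglongrightarrow> ?q z w" if w: "w \<in> V" for w
  proof -
    have "(\<Sum>u\<in>V. ?q z u * p 0 u w) = (\<Sum>u\<in>V. if u = w then ?q z u else 0)"
      using p w by (intro sum.cong refl) (auto simp: transition_function_def)
    then have "(\<Sum>u\<in>V. ?q z u * p 0 u w) = ?q z w" using w V by simp
    moreover have "((\<lambda>s. p s z w) has_real_derivative (\<Sum>u\<in>V. ?q z u * p 0 u w))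
        (at 0 within {0..})"
      using p z w unfolding transition_function_def by blast
    ultimately have "((\<lambda>s. (p s z w - p 0 z w) / (s - 0)) \<longlongrightarrow> ?q z w) (at 0 within {0..})"
      by (simp only: has_field_derivative_iff)
    moreover have "filterlim ?\<delta> (at 0 within {0..}) sequentially"
      using \<delta>0 by (auto simp: filterlim_at)
    ultimately have "(\<lambda>k. (p (?\<delta> k) z w - p 0 z w) / (?\<delta> k - 0)) \<longlonglongrightarrow> ?q z w"
      by (rule filterlim_compose)
    moreover have "p 0 z w = of_bool (z = w)"
      using p z w by (auto simp: transition_function_def)
    ultimately show ?thesis by simp
  qed
  \<comment> \<open>At points outside \<open>A\<close>, first-step analysis makes the entry
    probabilities invariant under \<open>p (?\<delta> k)\<close>.\<close>
  have "(\<Sum>w\<in>V. (p (?\<delta> k) z w - of_bool (z = w)) / ?\<delta> k * entry_prob V A (p (?\<delta> k)) y w) = 0" for k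
  proof -
    let ?e = "entry_prob V A (p (?\<delta> k)) y"
    have "?e z = (\<Sum>w\<in>V. p (?\<delta> k) z w * ?e w)"
      using z y summable_visit_prob[OF X p V _ _ y] by (intro entry_prob_step V) auto
    moreover have "(\<Sum>w\<in>V. of_bool (z = w) * ?e w) = (\<Sum>w\<in>V. if z = w then ?e w else 0)"
      by (intro sum.cong refl) auto
    ultimately have "(\<Sum>w\<in>V. (p (?\<delta> k) z w - of_bool (z = w)) * ?e w) = 0"
      using z V by (simp add: left_diff_distrib sum_subtractf)
    then have "(\<Sum>w\<in>V. (p (?\<delta> k) z w - of_bool (z = w)) * ?e w) / ?\<delta> k = 0" by (simp only: div_0)
    then show ?thesis by (simp only: sum_divide_distrib times_divide_eq_left)
  qed
  moreover have "(\<lambda>k. \<Sum>w\<in>V. (p (?\<delta> k) z w - of_bool (z = w)) / ?\<delta> k *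
      entry_prob V A (p (?\<delta> k)) y w) \<longlonglongrightarrow> (\<Sum>w\<in>V. ?q z w * ?h w)"
    by (intro tendsto_sum tendsto_mult slope h)
  ultimately have "(\<Sum>w\<in>V. ?q z w * ?h w) = 0"
    by (simp only: LIMSEQ_const_iff)
  \<comment> \<open>The diagonal entry of the generator is minus the sum of the other rates in its
    row, which supplies the terms with \<open>?h z\<close>.\<close>
  moreover have "(\<Sum>w\<in>V. ?q z w * ?h w) = (\<Sum>w\<in>V. c (z, w) * (?h w - ?h z))"
  proof -
    have split: "sum g V = g z + sum g (V - {z})" for g :: "'v \<Rightarrow> real"
      using V z by (simp add: sum.remove)
    have "(\<Sum>w\<in>V - {z}. ?q z w * ?h w) = (\<Sum>w\<in>V - {z}. c (z, w) * ?h w)"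
      by (intro sum.cong refl) (auto simp: generator_def)
    then show ?thesis
      unfolding split
      by (simp add: generator_def right_diff_distrib sum_subtractf sum_distrib_right)
  qed
  ultimately show ?thesis by (simp add: harmonic_at_def)
qed

end

section \<open>The reduction theorem\<close>

theorem theorem4p4:
  fixes G :: "'v pair_pre_digraph"
    and r :: "'v \<times> 'v \<Rightarrow> real"
    and V' S :: "'v set"
    and M :: "'v \<Rightarrow> 'w measure"
    and X :: "real \<Rightarrow> 'w \<Rightarrow> 'v"
    and x :: 'v
  assumes "pair_fin_digraph G"
    and "strongly_connected (with_proj G)"
    and "\<And>e. e \<in> parcs G \<Longrightarrow> r e > 0"
    and "pverts G = V' \<union> S" and "V' \<inter> S = {}"
    and "\<And>z. z \<in> pverts G \<Longrightarrow> ctmc (M z) X (pverts G) (edge_rate G r) z"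
    and "x \<in> V'"
  shows "weight r (arborescences G x) =
         weight r (spanning_forests G V') *
         weight (reduced_rate G r M X V' S)
           (arborescences (reduced_graph V' (reduced_rate G r M X V' S)) x)"
proof -
  interpret pair_fin_digraph G by (rule assms(1))
  let ?V = "pverts G" and ?c = "edge_rate G r"
  let ?c' = "reduced_rate G r M X V' S" and ?P = "\<lambda>w y. first_entry_prob (M w) X V' y"
  have wf: "pair_wf_digraph G" ..
  have V: "finite ?V" by (rule pair_finite_verts)
  have V': "V' \<subseteq> ?V" and S: "S = ?V - V'" using assms(4,5) by auto
  have nonneg: "?c e \<ge> 0" for e
    using assms(3)[of e] by (auto simp: edge_rate_def)
  \<comment> \<open>A closed set contains everything reachable from any of its points.\<close>
  have "A = ?V" if A: "A \<subseteq> ?V" "A \<noteq> {}" "\<forall>a\<in>A. \<forall>b\<in>?V. ?c (a, b) > 0 \<longrightarrow> b \<in> A" for A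
  proof -
    obtain a where a: "a \<in> A" using A(2) by blast
    have "b \<in> A" if "b \<in> ?V" for b
    proof -
      have "a \<rightarrow>\<^sup>*\<^bsub>with_proj G\<^esub> b"
        using assms(2) a A(1) that by (auto simp: strongly_connected_def)
      then show ?thesis
      proof (induction rule: reachable_induct)
        case base
        then show ?case using a by simp
      next
        case (step u v)
        then have "(u, v) \<in> parcs G" by simp
        then show ?case
          using step.IH A(3) assms(3) in_arcsD2 by (auto simp: edge_rate_def)
      qed
    qed
    then show ?thesis using A(1) by blast
  qed
  then have irr: "irreducible_on ?V ?c" by (auto simp: irreducible_on_def)
  have "weight r (arborescences G x) = forest_weight ?c ?V {x}"
    unfolding arborescences_eq_spanning_forests
    using assms(7) V' by (intro weight_spanning_forests wf V) (auto simp: edge_rate_def)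
  also have "\<dots> = forest_weight ?c ?V V' * forest_weight ?c' V' {x}"
  proof (rule forest_weight_reduction[OF V V' irr, where P = ?P])
    show "?P w y = of_bool (w = y)" if "y \<in> V'" "w \<in> V'" for y w
      using that V' by (intro first_entry_prob_in[OF V assms(6)]) auto
    show "harmonic_at ?V ?c (\<lambda>w. ?P w y) z" if "y \<in> V'" "z \<in> ?V - V'" for y z
      using that by (intro first_entry_prob_harmonic[OF V assms(6)]) auto
  qed (use assms(7) nonneg in \<open>auto simp: reduced_rate_def S\<close>)
  also have "forest_weight ?c ?V V' = weight r (spanning_forests G V')"
    by (rule weight_spanning_forests[symmetric, OF wf V V']) (auto simp: edge_rate_def)
  also have "forest_weight ?c' V' {x} = weight ?c' (arborescences (reduced_graph V' ?c') x)"
  proof -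
    have "pair_wf_digraph (reduced_graph V' ?c')"
      by unfold_locales (auto simp: reduced_graph_def)
    moreover have "?c' e \<ge> 0" for e
      by (cases e) (auto simp: reduced_rate_def first_entry_prob_def nonneg
          intro!: add_nonneg_nonneg sum_nonneg)
    \<comment> \<open>Being nonnegative, the reduced rates vanish at all pairs of distinct vertices
      of \<open>V'\<close> that are not reduced arcs.\<close>
    then have "?c' e = 0" if "\<not> ?c' e > 0" for e
      using that by (metis order_le_less)
    ultimately show ?thesis
      unfolding arborescences_eq_spanning_forests
      using weight_spanning_forests[of "reduced_graph V' ?c'" "{x}" ?c' ?c'] assms(7)
        finite_subset[OF V' V]
      by (auto simp: reduced_graph_def)
  qed
  finally show ?thesis .
qed

end
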